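(* Let $\mathcal S=(\Xi,\Sigma,S^p)$ be a weak spherical datum with respect to $G$, and let $s$ be the unique involution on $\Sigma^\wedge$ whose orbits are precisely the sets $\sigma^\wedge$, $\sigma\in\Sigma$. Then the action of $s$ on the set $\Sigma^\wedge$ of simple roots of the associated group $G^\wedge_{\mathcal S}$ is a folding.
   Context: SETTING. $(\Lambda,S,\Lambda^\vee,S^\vee)$ is a based root datum with finite root system $\Phi\subseteq\Lambda$, simple roots $S$, positive roots $\Phi^+$, Weyl group $W$; $\langle\cdot\mid\cdot\rangle$ is the pairing between a lattice and its dual. $G$ is a connected reductive group over an algebraically closed field of characteristic $0$ with this based root datum. $G^\vee$ is the connected reductive group over $\mathbb C$ with based root datum $(\Lambda^\vee,S^\vee,\Lambda,S)$, with maximal torus $T^\vee$ (character group $\Lambda^\vee$) and root system $\Phi^\vee$. WEAK SPHERICAL DATUM. A triple $\mathcal S=(\Xi,\Sigma,S^p)$ with $\Xi\subseteq\Lambda$ a subgroup and $\Sigma\subseteq\Xi$, $S^p\subseteq S$ subsets such that: (i) For every $\sigma\in\Sigma$ there is a subset $|\sigma|\subseteq S$ (the support) with $\sigma=\sum_{\alpha\in|\sigma|}n_\alpha\alpha$, $n_\alpha\ge1$, such that $|\sigma|$ (as a Dynkin diagram, simple roots numbered as in Bourbaki), $\sigma$ and $|\sigma|\cap S^p$ form one of the following: $A_1$: $\alpha_1$, $\varnothing$; $A_n$ ($n\ge2$): $\alpha_1+\dots+\alpha_n$, $\{\alpha_2,\dots,\alpha_{n-1}\}$; $B_n$ ($n\ge2$):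 $\alpha_1+\dots+\alpha_n$, $\{\alpha_2,\dots,\alpha_n\}$; $B_n$ ($n\ge2$): $\alpha_1+\dots+\alpha_n$, $\{\alpha_2,\dots,\alpha_{n-1}\}$; $C_n$ ($n\ge3$): $\alpha_1+2\alpha_2+\dots+2\alpha_{n-1}+\alpha_n$, $\{\alpha_1,\alpha_3,\dots,\alpha_n\}$; $C_n$ ($n\ge3$): same $\sigma$, $\{\alpha_3,\dots,\alpha_n\}$; $F_4$: $\alpha_1+2\alpha_2+3\alpha_3+2\alpha_4$, $\{\alpha_1,\alpha_2,\alpha_3\}$; $G_2$ ($\alpha_1$ short): $2\alpha_1+\alpha_2$, $\{\alpha_2\}$; $G_2$: $\alpha_1+\alpha_2$, $\varnothing$; $D_2$ (two orthogonal simple roots): $\alpha_1+\alpha_2$, $\varnothing$; $D_n$ ($n\ge3$; for $n=3$, $\alpha_1$ is joined to $\alpha_2$ and $\alpha_3$): $2\alpha_1+\dots+2\alpha_{n-2}+\alpha_{n-1}+\alpha_n$, $\{\alpha_2,\dots,\alpha_n\}$; $B_3$: $\alpha_1+2\alpha_2+3\alpha_3$, $\{\alpha_1,\alpha_2\}$. (ii) $\langle\Xi\mid\alpha^\vee\rangle=0$ for all $\alpha\in S^p$. (iii) If $\sigma=\alpha+\beta\in\Sigma$ is of type $D_2$ ($\alpha,\beta\in S$, $\alpha\perp\beta$), then $\langle\Xi\mid\alpha^\vee-\beta^\vee\rangle=0$. (iv) If $\alpha,\beta\in S$ with $\alpha,\alpha+\beta\in\Sigma$, then $\langle\beta\mid\alpha^\vee\rangle\ne-1$.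 The elements $\sigma\in\Sigma$ with $\sigma\notin\Phi$ are exactly those in the last three rows ($D_2$, $D_n$, and $B_3$ with $\sigma=\alpha_1+2\alpha_2+3\alpha_3$). ASSOCIATED ROOTS. For $\sigma\in\Sigma\setminus\Phi$ there is a unique set $\{\gamma_1,\gamma_2\}\subseteq\Phi^+$ with $\sigma=\gamma_1+\gamma_2$, $(\mathbb Q\gamma_1+\mathbb Q\gamma_2)\cap\Phi=\{\pm\gamma_1,\pm\gamma_2\}$ and $\gamma_1^\vee-\gamma_2^\vee=\delta_1^\vee-\delta_2^\vee$ for some $\delta_1,\delta_2\in S$. Put $\sigma^\wedge:=\{\sigma^\vee\}$ (the coroot of $\sigma$) if $\sigma\in\Phi$, $\sigma^\wedge:=\{\gamma_1^\vee,\gamma_2^\vee\}$ if $\sigma\notin\Phi$, and $\Sigma^\wedge:=\bigcup_{\sigma\in\Sigma}\sigma^\wedge\subseteq\Phi^\vee$. The sets $\sigma^\wedge$ partition $\Sigma^\wedge$ into subsets of size at most $2$. The associated group $G^\wedge_{\mathcal S}\subseteq G^\vee$ is the unique connected reductive subgroup containing $T^\vee$ whose set of simple roots is $\Sigma^\wedge$; the coroot of the root $\gamma^\vee\in\Sigma^\wedge$ is $\gamma\in\Phi$. FOLDING. Let $R$ be the set of simple roots of a based root datum, and $\alpha\mapsto{}^s\alpha$ an involution of $R$ (i.e. $s^2=\mathrm{id}$); write ${}^s(\alpha^\vee):=({}^s\alpha)^\vee$ for the induced involution on simple coroots. Then $s$ is called a folding if for all $\alpha,\beta\in R$: (1) $\langle\alpha\mid{}^s\alpha^\vee\rangle=0$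 whenever $\alpha\ne{}^s\alpha$; (2) $\langle\alpha-{}^s\alpha\mid\beta^\vee+{}^s\beta^\vee\rangle=0$. *)

theory Defs
  imports Complex_Main
begin

definition zscale :: "int \<Rightarrow> 'a::ab_group_add \<Rightarrow> 'a" where
  "zscale k x = (if 0 \<le> k then ((+) x ^^ nat k) 0 else - (((+) x ^^ nat (- k)) 0))"

lemma zscale_zero [simp]: "zscale 0 x = 0"
  by (simp add: zscale_def)

lemma zscale_one [simp]: "zscale 1 x = x"
  by (simp add: zscale_def)

lemma zscale_succ: "zscale (k + 1) x = zscale k x + x"
proof -
  consider "0 \<le> k" | "k = - 1" | "k < - 1" by linarith
  then show ?thesis
  proof cases
    case 1
    then have "nat (k + 1) = Suc (nat k)" by simp
    with 1 show ?thesis by (simp add: zscale_def add.commute)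
  next
    case 2
    then show ?thesis by (simp add: zscale_def)
  next
    case 3
    then have "nat (- k) = Suc (nat (- (k + 1)))" by simp
    with 3 show ?thesis by (simp add: zscale_def)
  qed
qed

lemma zscale_pred: "zscale (k - 1) x = zscale k x - x"
  using zscale_succ [of "k - 1" x] by simp

lemma zscale_add_left: "zscale (k + l) x = zscale k x + zscale l x"
proof (induction l rule: int_induct [where k = 0])
  case (step1 i)
  have "zscale (k + (i + 1)) x = zscale (k + i) x + x"
    using zscale_succ [of "k + i" x] by (simp only: add.assoc)
  with step1 show ?case by (simp only: zscale_succ add.assoc)
next
  case (step2 i)
  have "zscale (k + (i - 1)) x = zscale (k + i) x - x"
    using zscale_pred [of "k + i" x] by (simp only: add_diff_eq)
  with step2 show ?case by (simp only: zscale_pred add_diff_eq)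
qed simp

lemma zscale_add_right: "zscale k (x + y) = zscale k x + zscale k y"
  by (induction k rule: int_induct [where k = 0]) (simp_all add: zscale_succ zscale_pred)

lemma zscale_zscale: "zscale k (zscale l x) = zscale (k * l) x"
proof (induction k rule: int_induct [where k = 0])
  case (step1 i)
  then show ?case by (simp add: zscale_succ distrib_right zscale_add_left)
next
  case (step2 i)
  have "zscale (i * l) x = zscale ((i - 1) * l) x + zscale l x"
    by (simp add: left_diff_distrib flip: zscale_add_left)
  with step2 show ?case by (simp add: zscale_pred)
qed simp

text \<open>Every abelian group is a \<open>\<int>\<close>-module; \<open>Z.subspace\<close>, \<open>Z.span\<close> and \<open>Z.independent\<close>
  are subgroups, generated subgroups and linear independence over \<open>\<int>\<close>.\<close>

interpretation Z: module zscale
  by unfold_locales (simp_all add: zscale_add_left zscale_add_right zscale_zscale)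


text \<open>The character lattice and its dual are the types \<open>'l\<close> and \<open>'m\<close>. The map \<open>coroot\<close> is only
  meaningful on \<open>roots\<close>.\<close>

record ('l, 'm) root_datum =
  pairing :: "'l \<Rightarrow> 'm \<Rightarrow> int"
  roots :: "'l set"
  coroot :: "'l \<Rightarrow> 'm"
  simples :: "'l set"

definition reflection :: "('l::ab_group_add, 'm) root_datum \<Rightarrow> 'l \<Rightarrow> 'l \<Rightarrow> 'l" where
  "reflection D \<alpha> x = x - zscale (pairing D x (coroot D \<alpha>)) \<alpha>"

definition nonneg_comb :: "'l::ab_group_add set \<Rightarrow> 'l \<Rightarrow> bool" where
  "nonneg_comb S x \<longleftrightarrow> (\<exists>c. (\<forall>\<alpha>\<in>S. 0 \<le> c \<alpha>) \<and> x = (\<Sum>\<alpha>\<in>S. zscale (c \<alpha>) \<alpha>))"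

definition positive_roots :: "('l::ab_group_add, 'm) root_datum \<Rightarrow> 'l set" where
  "positive_roots D = {\<beta> \<in> roots D. nonneg_comb (simples D) \<beta>}"

text \<open>The root systems are reduced, being root systems of connected reductive groups over
  algebraically closed fields. Freeness of the two lattices follows from perfectness.\<close>

locale based_root_datum =
  fixes D :: "('l::ab_group_add, 'm::ab_group_add) root_datum"
  assumes additive_left: "additive (\<lambda>x. pairing D x y)"
    and additive_right: "additive (pairing D x)"
    and perfect_left: "additive (f :: 'l \<Rightarrow> int) \<Longrightarrow> \<exists>!y. f = (\<lambda>x. pairing D x y)"
    and perfect_right: "additive (g :: 'm \<Rightarrow> int) \<Longrightarrow> \<exists>!x. g = pairing D x"
    and finitely_generated_left: "\<exists>B :: 'l set. finite B \<and> Z.span B = UNIV"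
    and finitely_generated_right: "\<exists>B :: 'm set. finite B \<and> Z.span B = UNIV"
    and finite_roots: "finite (roots D)"
    and inj_coroot: "inj_on (coroot D) (roots D)"
    and pairing_root_coroot: "\<alpha> \<in> roots D \<Longrightarrow> pairing D \<alpha> (coroot D \<alpha>) = 2"
    and reflection_root:
      "\<alpha> \<in> roots D \<Longrightarrow> \<beta> \<in> roots D \<Longrightarrow> reflection D \<alpha> \<beta> \<in> roots D"
    and reflection_coroot:
      "\<alpha> \<in> roots D \<Longrightarrow> \<beta> \<in> roots D \<Longrightarrow>
        coroot D \<beta> - zscale (pairing D \<alpha> (coroot D \<beta>)) (coroot D \<alpha>) \<in> coroot D ` roots D"
    and reduced: "\<alpha> \<in> roots D \<Longrightarrow> zscale 2 \<alpha> \<notin> roots D"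
    and simples_subset: "simples D \<subseteq> roots D"
    and simples_independent: "Z.independent (simples D)"
    and roots_pos_or_neg:
      "\<beta> \<in> roots D \<Longrightarrow> nonneg_comb (simples D) \<beta> \<or> nonneg_comb (simples D) (- \<beta>)"

definition dual_datum :: "('l, 'm) root_datum \<Rightarrow> ('m, 'l) root_datum" where
  "dual_datum D =
    \<lparr>pairing = (\<lambda>y x. pairing D x y),
     roots = coroot D ` roots D,
     coroot = inv_into (roots D) (coroot D),
     simples = coroot D ` simples D\<rparr>"


text \<open>Dynkin diagrams with the numbering \<open>1, \<dots>, n\<close> of Bourbaki.
  \<open>cartan X i j\<close> is the value of \<open>\<langle>\<alpha>\<^sub>i | \<alpha>\<^sub>j\<^sup>\<or>\<rangle>\<close>. So the last root of \<open>B\<^sub>n\<close> is short, the last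
  root of \<open>C\<^sub>n\<close> is long, \<open>\<alpha>\<^sub>3, \<alpha>\<^sub>4\<close> are short in \<open>F\<^sub>4\<close>, and \<open>\<alpha>\<^sub>1\<close> is short in \<open>G\<^sub>2\<close>.
  The formula for \<open>D\<^sub>n\<close> also covers \<open>n = 2\<close> (two orthogonal roots) and \<open>n = 3\<close> (\<open>\<alpha>\<^sub>1\<close> is joined
  to \<open>\<alpha>\<^sub>2\<close> and \<open>\<alpha>\<^sub>3\<close>).\<close>

datatype dynkin = Type_A nat | Type_B nat | Type_C nat | Type_D nat | Type_F4 | Type_G2

fun dynkin_rank :: "dynkin \<Rightarrow> nat" where
  "dynkin_rank (Type_A n) = n"
| "dynkin_rank (Type_B n) = n"
| "dynkin_rank (Type_C n) = n"
| "dynkin_rank (Type_D n) = n"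
| "dynkin_rank Type_F4 = 4"
| "dynkin_rank Type_G2 = 2"

definition path_cartan :: "nat \<Rightarrow> nat \<Rightarrow> int" where
  "path_cartan i j = (if i = j then 2 else if j = i + 1 \<or> i = j + 1 then - 1 else 0)"

fun cartan :: "dynkin \<Rightarrow> nat \<Rightarrow> nat \<Rightarrow> int" where
  "cartan (Type_A n) i j = path_cartan i j"
| "cartan (Type_B n) i j = (if i + 1 = n \<and> j = n then - 2 else path_cartan i j)"
| "cartan (Type_C n) i j = (if i = n \<and> j + 1 = n then - 2 else path_cartan i j)"
| "cartan (Type_D n) i j =
    (if {i, j} = {n - 1, n} then 0 else if {i, j} = {n - 2, n} then - 1 else path_cartan i j)"
| "cartan Type_F4 i j = (if i = 2 \<and> j = 3 then - 2 else path_cartan i j)"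
| "cartan Type_G2 i j = (if i = 2 \<and> j = 1 then - 3 else path_cartan i j)"

text \<open>\<open>spherical_table X c P\<close>: a row of the table, with \<open>X\<close> the diagram of \<open>|\<sigma>|\<close>,
  \<open>\<sigma> = \<Sum>\<^sub>i c\<^sub>i \<alpha>\<^sub>i\<close>, and \<open>P\<close> the set of indices of \<open>|\<sigma>| \<inter> S\<^sup>p\<close>. Values of \<open>c\<close> outside
  \<open>{1..dynkin_rank X}\<close> are irrelevant.\<close>

inductive spherical_table :: "dynkin \<Rightarrow> (nat \<Rightarrow> int) \<Rightarrow> nat set \<Rightarrow> bool" where
  A1: "spherical_table (Type_A 1) (\<lambda>_. 1) {}"
| An: "2 \<le> n \<Longrightarrow> spherical_table (Type_A n) (\<lambda>_. 1) {2..n - 1}"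
| Bn: "2 \<le> n \<Longrightarrow> spherical_table (Type_B n) (\<lambda>_. 1) {2..n}"
| Bn': "2 \<le> n \<Longrightarrow> spherical_table (Type_B n) (\<lambda>_. 1) {2..n - 1}"
| Cn: "3 \<le> n \<Longrightarrow>
    spherical_table (Type_C n) (\<lambda>i. if i = 1 \<or> i = n then 1 else 2) (insert 1 {3..n})"
| Cn': "3 \<le> n \<Longrightarrow>
    spherical_table (Type_C n) (\<lambda>i. if i = 1 \<or> i = n then 1 else 2) {3..n}"
| F4: "spherical_table Type_F4 (\<lambda>i. [1, 2, 3, 2] ! (i - 1)) {1, 2, 3}"
| G2: "spherical_table Type_G2 (\<lambda>i. [2, 1] ! (i - 1)) {2}"
| G2': "spherical_table Type_G2 (\<lambda>_. 1) {}"
| D2: "spherical_table (Type_D 2) (\<lambda>_. 1) {}"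
| Dn: "3 \<le> n \<Longrightarrow>
    spherical_table (Type_D n) (\<lambda>i. if n - 1 \<le> i then 1 else 2) {2..n}"
| B3: "spherical_table (Type_B 3) (\<lambda>i. [1, 2, 3] ! (i - 1)) {1, 2}"

text \<open>The support \<open>|\<sigma>|\<close> is enumerated as \<open>\<alpha> 1, \<dots>, \<alpha> n\<close>.\<close>

definition table_root ::
    "('l::ab_group_add, 'm) root_datum \<Rightarrow> 'l set \<Rightarrow> 'l \<Rightarrow> bool" where
  "table_root D Sp \<sigma> \<longleftrightarrow>
    (\<exists>X c P \<alpha>. spherical_table X c P \<and>
      inj_on \<alpha> {1..dynkin_rank X} \<and> \<alpha> ` {1..dynkin_rank X} \<subseteq> simples D \<and>
      (\<forall>i\<in>{1..dynkin_rank X}. \<forall>j\<in>{1..dynkin_rank X}.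
        pairing D (\<alpha> i) (coroot D (\<alpha> j)) = cartan X i j) \<and>
      \<sigma> = (\<Sum>i\<in>{1..dynkin_rank X}. zscale (c i) (\<alpha> i)) \<and>
      \<alpha> ` {1..dynkin_rank X} \<inter> Sp = \<alpha> ` P)"

definition weak_spherical_datum ::
    "('l::ab_group_add, 'm::ab_group_add) root_datum \<Rightarrow> 'l set \<Rightarrow> 'l set \<Rightarrow> 'l set \<Rightarrow> bool" where
  "weak_spherical_datum D \<Xi> \<Sigma> Sp \<longleftrightarrow>
    Z.subspace \<Xi> \<and> \<Sigma> \<subseteq> \<Xi> \<and> Sp \<subseteq> simples D \<and>
    (\<forall>\<sigma>\<in>\<Sigma>. table_root D Sp \<sigma>) \<and>
    (\<forall>\<xi>\<in>\<Xi>. \<forall>\<alpha>\<in>Sp. pairing D \<xi> (coroot D \<alpha>) = 0) \<and>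
    (\<forall>\<alpha>\<in>simples D. \<forall>\<beta>\<in>simples D.
      pairing D \<alpha> (coroot D \<beta>) = 0 \<and> \<alpha> + \<beta> \<in> \<Sigma> \<longrightarrow>
      (\<forall>\<xi>\<in>\<Xi>. pairing D \<xi> (coroot D \<alpha> - coroot D \<beta>) = 0)) \<and>
    (\<forall>\<alpha>\<in>simples D. \<forall>\<beta>\<in>simples D.
      \<alpha> \<in> \<Sigma> \<and> \<alpha> + \<beta> \<in> \<Sigma> \<longrightarrow> pairing D \<beta> (coroot D \<alpha>) \<noteq> - 1)"


text \<open>Lattice points of the rational span \<open>\<rat>x + \<rat>y\<close>, with denominators cleared.\<close>

definition rat_span2 :: "'l::ab_group_add \<Rightarrow> 'l \<Rightarrow> 'l set" where
  "rat_span2 x y = {z. \<exists>k a b. k \<noteq> 0 \<and> zscale k z = zscale a x + zscale b y}"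

definition associated_pair ::
    "('l::ab_group_add, 'm::ab_group_add) root_datum \<Rightarrow> 'l \<Rightarrow> 'l set \<Rightarrow> bool" where
  "associated_pair D \<sigma> P \<longleftrightarrow>
    (\<exists>\<gamma>1 \<gamma>2. P = {\<gamma>1, \<gamma>2} \<and> P \<subseteq> positive_roots D \<and> \<sigma> = \<gamma>1 + \<gamma>2 \<and>
      rat_span2 \<gamma>1 \<gamma>2 \<inter> roots D = {\<gamma>1, - \<gamma>1, \<gamma>2, - \<gamma>2} \<and>
      (\<exists>\<delta>1\<in>simples D. \<exists>\<delta>2\<in>simples D.
        coroot D \<gamma>1 - coroot D \<gamma>2 = coroot D \<delta>1 - coroot D \<delta>2))"

definition hat :: "('l::ab_group_add, 'm::ab_group_add) root_datum \<Rightarrow> 'l \<Rightarrow> 'm set" where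
  "hat D \<sigma> =
    (if \<sigma> \<in> roots D then {coroot D \<sigma>} else coroot D ` (THE P. associated_pair D \<sigma> P))"

definition hat_set :: "('l::ab_group_add, 'm::ab_group_add) root_datum \<Rightarrow> 'l set \<Rightarrow> 'm set" where
  "hat_set D \<Sigma> = (\<Union>\<sigma>\<in>\<Sigma>. hat D \<sigma>)"

text \<open>A connected reductive group enters through its based root datum. The connected reductive
  subgroup containing the maximal torus of \<open>E\<close> with set of simple roots \<open>R\<close> has the lattices of
  \<open>E\<close>, the coroots of \<open>E\<close>, and as roots the orbit of \<open>R\<close> under the reflections in \<open>R\<close>.\<close>

inductive_set generated_roots :: "('l::ab_group_add, 'm) root_datum \<Rightarrow> 'l set \<Rightarrow> 'l set"
  for E :: "('l, 'm) root_datum" and R :: "'l set" where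
  base: "\<alpha> \<in> R \<Longrightarrow> \<alpha> \<in> generated_roots E R"
| reflect: "\<beta> \<in> generated_roots E R \<Longrightarrow> \<alpha> \<in> R \<Longrightarrow> reflection E \<alpha> \<beta> \<in> generated_roots E R"

definition subgroup_datum ::
    "('l::ab_group_add, 'm) root_datum \<Rightarrow> 'l set \<Rightarrow> ('l, 'm) root_datum" where
  "subgroup_datum E R = E\<lparr>roots := generated_roots E R, simples := R\<rparr>"

definition associated_datum ::
    "('l::ab_group_add, 'm::ab_group_add) root_datum \<Rightarrow> 'l set \<Rightarrow> ('m, 'l) root_datum" where
  "associated_datum D \<Sigma> = subgroup_datum (dual_datum D) (hat_set D \<Sigma>)"


text \<open>Involutions of a set \<open>R\<close> are extensional functions, so that they are determined by
  their action on \<open>R\<close>.\<close>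

definition involution_on :: "'a set \<Rightarrow> ('a \<Rightarrow> 'a) \<Rightarrow> bool" where
  "involution_on R s \<longleftrightarrow>
    (\<forall>x\<in>R. s x \<in> R \<and> s (s x) = x) \<and> (\<forall>x. x \<notin> R \<longrightarrow> s x = undefined)"

definition involution_orbits :: "'a set \<Rightarrow> ('a \<Rightarrow> 'a) \<Rightarrow> 'a set set" where
  "involution_orbits R s = (\<lambda>x. {x, s x}) ` R"

text \<open>The notion is meant for based root data, but its clauses only involve the simple roots, their
  coroots and the pairing.\<close>

definition is_folding ::
    "('l::ab_group_add, 'm::ab_group_add) root_datum \<Rightarrow> ('l \<Rightarrow> 'l) \<Rightarrow> bool" where
  "is_folding E s \<longleftrightarrow>
    involution_on (simples E) s \<and>
    (\<forall>\<alpha>\<in>simples E. \<alpha> \<noteq> s \<alpha> \<longrightarrow> pairing E \<alpha> (coroot E (s \<alpha>)) = 0) \<and>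
    (\<forall>\<alpha>\<in>simples E. \<forall>\<beta>\<in>simples E.
      pairing E (\<alpha> - s \<alpha>) (coroot E \<beta> + coroot E (s \<beta>)) = 0)"

end

theory Submission
  imports Defs
begin

text \<open>Call an element of \<open>\<Sigma>\<close> that is a root \<^emph>\<open>ordinary\<close>. If \<open>\<sigma>\<close> is not ordinary, then its associated pair
satisfies \<open>\<sigma> = \<gamma>\<^sub>1 + \<gamma>\<^sub>2\<close>, \<open>\<gamma>\<^sub>1 \<perp> \<gamma>\<^sub>2\<close> and \<open>\<gamma>\<^sub>1\<^sup>\<or> - \<gamma>\<^sub>2\<^sup>\<or> = \<delta>\<^sub>1\<^sup>\<or> - \<delta>\<^sub>2\<^sup>\<or>\<close> with simple roots \<open>\<delta>\<^sub>1, \<delta>\<^sub>2\<close> that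
either lie in \<open>S\<^sup>p\<close> (types \<open>D\<^sub>n\<close>, \<open>n \<ge> 3\<close>, and \<open>B\<^sub>3\<close>) or have sum \<open>\<sigma>\<close> (type \<open>D\<^sub>2\<close>). In both cases
the conditions on a weak spherical datum say that \<open>\<delta>\<^sub>1\<^sup>\<or> - \<delta>\<^sub>2\<^sup>\<or>\<close> vanishes on \<open>\<Xi>\<close>. Hence

\<^item> \<open>\<langle>\<tau> | \<gamma>\<^sub>1\<^sup>\<or> - \<gamma>\<^sub>2\<^sup>\<or>\<rangle> = 0\<close> for all \<open>\<tau> \<in> \<Sigma>\<close>.

Everything follows from this equation. The sum of the coroots of \<open>w\<close> and \<open>s w\<close>, for \<open>w\<close> in \<open>\<tau>\<^sup>\<and>\<close>, is
\<open>\<tau>\<close> or \<open>2\<tau>\<close>, so the equation is the second folding condition, and \<open>\<gamma>\<^sub>1 \<perp> \<gamma>\<^sub>2\<close> is the first one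
(\<open>folding_of_hat_orbits\<close>). The involution exists and is unique because different sets \<open>\<sigma>\<^sup>\<and>\<close> are
disjoint (\<open>hat_disjoint\<close>, \<open>ex1_involution_with_orbits\<close>). Indeed, an ordinary \<open>\<tau> = \<gamma>\<^sub>1\<close> would give
\<open>\<langle>\<tau> | \<gamma>\<^sub>1\<^sup>\<or> - \<gamma>\<^sub>2\<^sup>\<or>\<rangle> = 2\<close>, and \<open>\<tau> = \<gamma>\<^sub>1 + \<gamma>\<^sub>3\<close> with \<open>\<gamma>\<^sub>1 \<perp> \<gamma>\<^sub>3\<close> forces
\<open>\<langle>\<gamma>\<^sub>3 | \<gamma>\<^sub>2\<^sup>\<or>\<rangle> = \<langle>\<gamma>\<^sub>2 | \<gamma>\<^sub>3\<^sup>\<or>\<rangle> = 2\<close>, that is \<open>\<gamma>\<^sub>2 = \<gamma>\<^sub>3\<close>.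

The bulk of the work is the existence and uniqueness of the associated pair, since \<open>\<sigma>\<^sup>\<and>\<close> is defined
through it (\<open>special_pair_exists\<close>). All rows of the table other than \<open>D\<^sub>2\<close>, \<open>D\<^sub>n\<close> and the last \<open>B\<^sub>3\<close>
give roots (\<open>table_root_cases\<close>); in these three rows the pair can be written down:

\<^item> \<open>D\<^sub>2\<close>: \<open>\<alpha>\<^sub>1\<close> and \<open>\<alpha>\<^sub>2\<close>;
\<^item> \<open>D\<^sub>n\<close>: \<open>\<alpha>\<^sub>1 + \<dots> + \<alpha>\<^sub>n\<^sub>-\<^sub>2 + \<alpha>\<^sub>n\<^sub>-\<^sub>1\<close> and \<open>\<alpha>\<^sub>1 + \<dots> + \<alpha>\<^sub>n\<^sub>-\<^sub>2 + \<alpha>\<^sub>n\<close>, with \<open>\<delta>\<^sub>1, \<delta>\<^sub>2 = \<alpha>\<^sub>n\<^sub>-\<^sub>1, \<alpha>\<^sub>n\<close>;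
\<^item> \<open>B\<^sub>3\<close>: \<open>\<alpha>\<^sub>1 + \<alpha>\<^sub>2 + 2\<alpha>\<^sub>3\<close> and \<open>\<alpha>\<^sub>2 + \<alpha>\<^sub>3\<close>, with \<open>\<delta>\<^sub>1, \<delta>\<^sub>2 = \<alpha>\<^sub>1, \<alpha>\<^sub>2\<close>.

The main tool is the Weyl-invariant form \<open>(x, y) = \<Sum>\<langle>x | \<alpha>\<^sup>\<or>\<rangle>\<langle>y | \<alpha>\<^sup>\<or>\<rangle>\<close>, summed over all roots. It is
definite on the span of the roots and satisfies \<open>2(x, \<beta>) = (\<beta>, \<beta>)\<langle>x | \<beta>\<^sup>\<or>\<rangle>\<close>. So an identity between
coroots is the same as one between the vectors \<open>\<beta> / (\<beta>, \<beta>)\<close>. For uniqueness in the last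
two rows, norms of integral combinations of the simple roots in \<open>|\<sigma>|\<close> are multiples of the smallest
norm \<open>N\<close> of such a simple root, while \<open>(\<gamma>\<^sub>1, \<gamma>\<^sub>1) + (\<gamma>\<^sub>2, \<gamma>\<^sub>2) = (\<sigma>, \<sigma>)\<close> is \<open>2N\<close> for \<open>D\<^sub>n\<close> and \<open>3N\<close> for \<open>B\<^sub>3\<close>. This determines the
two norms, and then the identity of coroots is a linear equation for \<open>\<gamma>\<^sub>1\<close> and \<open>\<gamma>\<^sub>2\<close>.
\<close>

section \<open>Involutions with prescribed orbits\<close>

text \<open>The involution sends \<open>x\<close> to the other element of the member of \<open>F\<close> that contains \<open>x\<close>, or to \<open>x\<close> itself
if that member is a singleton. Disjointness makes this choice consistent, and it is also what forces
any two such involutions to agree.\<close>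

lemma ex1_involution_with_orbits:
  fixes F :: "'a set set"
  assumes pairs: "\<And>A. A \<in> F \<Longrightarrow> \<exists>a b. A = {a, b}"
    and disjoint: "\<And>A B. A \<in> F \<Longrightarrow> B \<in> F \<Longrightarrow> A \<inter> B \<noteq> {} \<Longrightarrow> A = B"
  shows "\<exists>!s. involution_on (\<Union>F) s \<and> involution_orbits (\<Union>F) s = F"
proof (rule ex_ex1I)
  have "\<exists>y. {x, y} \<in> F" if "x \<in> \<Union>F" for x
  proof -
    from that obtain A where A: "A \<in> F" "x \<in> A" by blast
    with pairs obtain a b where "A = {a, b}" by blast
    with A have "{x, if x = a then b else a} \<in> F" by (auto simp: insert_commute)
    then show ?thesis ..
  qed
  then obtain f where f: "\<And>x. x \<in> \<Union>F \<Longrightarrow> {x, f x} \<in> F"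
    by metis
  define s where "s = (\<lambda>x. if x \<in> \<Union>F then f x else undefined)"
  have s: "{x, s x} \<in> F" if "x \<in> \<Union>F" for x
    using f that by (simp add: s_def)
  have mem: "s x \<in> \<Union>F" if "x \<in> \<Union>F" for x
    using s [OF that] by blast
  have inv: "s (s x) = x" if "x \<in> \<Union>F" for x
  proof -
    have "{x, s x} = {s x, s (s x)}"
      by (rule disjoint) (use s that mem in auto)
    then show ?thesis by (auto simp: doubleton_eq_iff)
  qed
  have "involution_on (\<Union>F) s"
    unfolding involution_on_def using mem inv by (auto simp: s_def)
  moreover have "involution_orbits (\<Union>F) s = F"
  proof
    show "involution_orbits (\<Union>F) s \<subseteq> F"
      using s by (auto simp: involution_orbits_def)
    show "F \<subseteq> involution_orbits (\<Union>F) s"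
    proof
      fix A assume A: "A \<in> F"
      then obtain a where a: "a \<in> A" using pairs by blast
      then have "A = {a, s a}"
        by (intro disjoint) (use A s in auto)
      then show "A \<in> involution_orbits (\<Union>F) s"
        using a A by (auto simp: involution_orbits_def)
    qed
  qed
  ultimately show "\<exists>s. involution_on (\<Union>F) s \<and> involution_orbits (\<Union>F) s = F" by blast
next
  fix s t
  assume s: "involution_on (\<Union>F) s \<and> involution_orbits (\<Union>F) s = F"
    and t: "involution_on (\<Union>F) t \<and> involution_orbits (\<Union>F) t = F"
  show "s = t"
  proof
    fix x
    show "s x = t x"
    proof (cases "x \<in> \<Union>F")
      case True
      have orbit: "{x, r x} \<in> F" if "involution_orbits (\<Union>F) r = F" for r
      proof -
        have "{x, r x} \<in> involution_orbits (\<Union>F) r"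
          unfolding involution_orbits_def using True by (rule imageI)
        then show ?thesis by (simp only: that)
      qed
      have "{x, s x} = {x, t x}"
        by (rule disjoint [OF orbit [OF conjunct2 [OF s]] orbit [OF conjunct2 [OF t]]]) simp
      then show ?thesis by (auto simp: doubleton_eq_iff)
    next
      case False
      then show ?thesis using s t by (simp add: involution_on_def)
    qed
  qed
qed


section \<open>Integral combinations and sums of Cartan integers\<close>

lemma zscale_two: "zscale 2 x = x + x"
  using zscale_add_left [of 1 1 x] by simp

lemma zscale_three: "zscale 3 x = x + x + x"
  using zscale_add_left [of 2 1 x] by (simp add: zscale_two)

lemma nonneg_comb_zero: "nonneg_comb S 0"
  unfolding nonneg_comb_def by (rule exI [of _ "\<lambda>_. 0"]) simp

lemma nonneg_comb_add: "nonneg_comb S x \<Longrightarrow> nonneg_comb S y \<Longrightarrow> nonneg_comb S (x + y)"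
  unfolding nonneg_comb_def
proof (elim exE conjE, goal_cases)
  case (1 c d)
  then show ?case
    by (intro exI [of _ "\<lambda>\<alpha>. c \<alpha> + d \<alpha>"]) (simp add: zscale_add_left sum.distrib)
qed

lemma nonneg_comb_sum: "(\<And>i. i \<in> A \<Longrightarrow> nonneg_comb S (f i)) \<Longrightarrow> nonneg_comb S (\<Sum>i\<in>A. f i)"
  by (induction A rule: infinite_finite_induct) (auto intro: nonneg_comb_zero nonneg_comb_add)

lemma rat_span2I: "zscale a x + zscale b y \<in> rat_span2 x y"
  unfolding rat_span2_def by (rule CollectI, rule exI [of _ 1]) (metis one_neq_zero zscale_one)

lemma atLeastAtMost_1_numeral:
  "{Suc 0..2} = {Suc 0, 2}" "{Suc 0..3} = {Suc 0, 2, 3}" "{Suc 0..4} = {Suc 0, 2, 3, 4}"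
  by auto

text \<open>Pairing the sum of a segment of a path with one simple coroot: 2 from the vertex itself and \<open>- 1\<close> from
each of its neighbours, as far as they lie in the segment.\<close>

lemma path_cartan_sum:
  "(\<Sum>i=a..b. path_cartan i j) =
    (if a \<le> j \<and> j \<le> b then 2 else 0) - (if a \<le> j + 1 \<and> j + 1 \<le> b then 1 else 0)
    - (if a + 1 \<le> j \<and> j \<le> b + 1 then 1 else 0)"
proof -
  have "(\<Sum>i=a..b. path_cartan i j) =
      (\<Sum>i=a..b. (if i = j then 2 else 0) - (if i = j + 1 then 1 else 0)
        - (if 1 \<le> j \<and> i = j - 1 then 1 else 0))"
    by (rule sum.cong) (auto simp: path_cartan_def)
  also have "\<dots> = (\<Sum>i=a..b. if i = j then 2 else 0) - (\<Sum>i=a..b. if i = j + 1 then 1 else 0)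
      - (if 1 \<le> j then \<Sum>i=a..b. if i = j - 1 then 1 else 0 else 0)"
    by (simp add: sum_subtractf)
  also have "\<dots> = (if a \<le> j \<and> j \<le> b then 2 else 0) - (if a \<le> j + 1 \<and> j + 1 \<le> b then 1 else 0)
    - (if a + 1 \<le> j \<and> j \<le> b + 1 then 1 else 0)"
    by auto
  finally show ?thesis .
qed


section \<open>The invariant form\<close>

context based_root_datum
begin

abbreviation coroot_pairing :: "'l \<Rightarrow> 'l \<Rightarrow> int" (\<open>\<langle>_ | _\<rangle>\<close>) where
  "\<langle>x | \<beta>\<rangle> \<equiv> pairing D x (coroot D \<beta>)"

lemma pairing_add_left: "pairing D (x + y) v = pairing D x v + pairing D y v"
  using additive_left by (simp add: additive_def)

lemma pairing_add_right: "pairing D x (v + w) = pairing D x v + pairing D x w"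
  using additive_right by (simp add: additive_def)

lemma pairing_zero_left [simp]: "pairing D 0 v = 0"
  using pairing_add_left [of 0 0 v] by simp

lemma pairing_zero_right [simp]: "pairing D x 0 = 0"
  using pairing_add_right [of x 0 0] by simp

lemma pairing_minus_left: "pairing D (- x) v = - pairing D x v"
  using pairing_add_left [of x "- x" v] by simp

lemma pairing_minus_right: "pairing D x (- v) = - pairing D x v"
  using pairing_add_right [of x v "- v"] by simp

lemma pairing_diff_left: "pairing D (x - y) v = pairing D x v - pairing D y v"
  using pairing_add_left [of x "- y" v] by (simp add: pairing_minus_left)

lemma pairing_diff_right: "pairing D x (v - w) = pairing D x v - pairing D x w"
  using pairing_add_right [of x v "- w"] by (simp add: pairing_minus_right)

lemma pairing_zscale_left: "pairing D (zscale k x) v = k * pairing D x v"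
  by (induction k rule: int_induct [where k = 0])
    (simp_all add: zscale_succ zscale_pred pairing_add_left pairing_diff_left algebra_simps)

lemma pairing_zscale_right: "pairing D x (zscale k v) = k * pairing D x v"
  by (induction k rule: int_induct [where k = 0])
    (simp_all add: zscale_succ zscale_pred pairing_add_right pairing_diff_right algebra_simps)

lemma pairing_sum_left: "pairing D (\<Sum>i\<in>A. f i) v = (\<Sum>i\<in>A. pairing D (f i) v)"
  by (induction A rule: infinite_finite_induct) (simp_all add: pairing_add_left)

lemmas pairing_linear =
  pairing_add_left pairing_minus_left pairing_diff_left pairing_zscale_left pairing_sum_left
  pairing_add_right pairing_minus_right pairing_diff_right pairing_zscale_right

lemma coroot_eqI:
  assumes "\<And>x. pairing D x v = pairing D x w"
  shows "v = w"
  using perfect_left [of "\<lambda>x. pairing D x w"] additive_left assms by metis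

text \<open>Torsion-freeness comes from the perfect pairing: a torsion element pairs to 0 with everything.\<close>

lemma zscale_eq_0_iff: "zscale k (x :: 'l) = 0 \<longleftrightarrow> k = 0 \<or> x = 0"
proof
  assume *: "zscale k x = 0"
  have "x = 0" if "k \<noteq> 0"
  proof -
    have "pairing D x v = 0" for v
      using arg_cong [OF *, of "\<lambda>y. pairing D y v"] that by (simp add: pairing_linear)
    then have "pairing D x = (\<lambda>v. 0)" "pairing D 0 = (\<lambda>v. 0)" by auto
    moreover have "additive (\<lambda>v :: 'm. 0 :: int)" by (simp add: additive_def)
    ultimately show ?thesis using perfect_right [of "\<lambda>v. 0"] by metis
  qed
  then show "k = 0 \<or> x = 0" by blast
qed auto

lemma zscale_cancel: "zscale k (x :: 'l) = zscale k y \<longleftrightarrow> k = 0 \<or> x = y"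
  using zscale_eq_0_iff [of k "x - y"] by (simp add: Z.scale_right_diff_distrib)

lemma root_nonzero: "\<beta> \<in> roots D \<Longrightarrow> \<beta> \<noteq> 0"
  using pairing_root_coroot [of \<beta>] by auto

lemma uminus_root: "\<beta> \<in> roots D \<Longrightarrow> - \<beta> \<in> roots D"
  using reflection_root [of \<beta> \<beta>] zscale_add_left [of 1 1 \<beta>]
  by (simp add: reflection_def pairing_root_coroot)

lemma finite_simples: "finite (simples D)"
  using finite_subset [OF simples_subset finite_roots] .

lemma simple_root: "\<alpha> \<in> simples D \<Longrightarrow> \<alpha> \<in> roots D"
  using simples_subset by auto

text \<open>The sum runs over the set of coroots rather than over the roots, so that the invariance can be read
off from a permutation of the index set by dual reflections.\<close>

definition form :: "'l \<Rightarrow> 'l \<Rightarrow> int" where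
  "form x y = (\<Sum>v\<in>coroot D ` roots D. pairing D x v * pairing D y v)"

lemma form_commute: "form x y = form y x"
  by (simp add: form_def mult.commute)

lemma form_add_left: "form (x + y) z = form x z + form y z"
  by (simp add: form_def pairing_linear sum.distrib algebra_simps)

lemma form_zscale_left: "form (zscale k x) z = k * form x z"
  by (simp add: form_def pairing_linear sum_distrib_left mult.assoc)

lemma form_minus_left: "form (- x) z = - form x z"
  using form_zscale_left [of "- 1" x z] by simp

lemma form_diff_left: "form (x - y) z = form x z - form y z"
  using form_add_left [of x "- y" z] by (simp add: form_minus_left)

lemmas form_left = form_add_left form_diff_left form_minus_left form_zscale_left

lemma form_right:
  "form z (x + y) = form z x + form z y" "form z (x - y) = form z x - form z y"
  "form z (- x) = - form z x" "form z (zscale k x) = k * form z x"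
  using form_left by (simp_all add: form_commute)

lemmas form_linear = form_left form_right

lemma form_reflection:
  assumes \<beta>: "\<beta> \<in> roots D"
  shows "form (reflection D \<beta> x) (reflection D \<beta> y) = form x y"
proof -
  define r where "r v = v - zscale (pairing D \<beta> v) (coroot D \<beta>)" for v
  have r_r: "r (r v) = v" for v
    using zscale_add_left [of "pairing D \<beta> v" "- pairing D \<beta> v" "coroot D \<beta>"] pairing_root_coroot [OF \<beta>]
    by (simp add: r_def pairing_linear)
  have r_mem: "r v \<in> coroot D ` roots D" if "v \<in> coroot D ` roots D" for v
    using that reflection_coroot \<beta> by (auto simp: r_def)
  have swap: "pairing D (reflection D \<beta> x) v = pairing D x (r v)" for x v
    by (simp add: reflection_def r_def pairing_linear)
  show ?thesis
    unfolding form_def swap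
    by (rule sum.reindex_bij_witness [where i = r and j = r]) (simp_all add: r_r r_mem)
qed

text \<open>Invariance under the reflection in \<open>\<beta>\<close> gives \<open>(x - \<langle>x | \<beta>\<rangle>\<beta>, - \<beta>) = (x, \<beta>)\<close>.\<close>

lemma form_root:
  assumes \<beta>: "\<beta> \<in> roots D"
  shows "2 * form x \<beta> = \<langle>x | \<beta>\<rangle> * form \<beta> \<beta>"
proof -
  have "reflection D \<beta> \<beta> = - \<beta>"
    using zscale_add_left [of 1 1 \<beta>] by (simp add: reflection_def pairing_root_coroot [OF \<beta>])
  with form_reflection [OF \<beta>, of x \<beta>] show ?thesis
    by (simp add: reflection_def form_linear pairing_root_coroot [OF \<beta>] algebra_simps)
qed

lemma form_root_pos:
  assumes \<beta>: "\<beta> \<in> roots D"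
  shows "0 < form \<beta> \<beta>"
proof -
  have "0 < \<langle>\<beta> | \<beta>\<rangle> * \<langle>\<beta> | \<beta>\<rangle>"
    by (simp add: pairing_root_coroot [OF \<beta>])
  also have "\<dots> \<le> form \<beta> \<beta>"
    unfolding form_def by (rule member_le_sum) (use \<beta> finite_roots in auto)
  finally show ?thesis .
qed

lemma pairing_root_commute:
  assumes "\<beta> \<in> roots D" "\<gamma> \<in> roots D"
  shows "\<langle>\<beta> | \<gamma>\<rangle> * form \<gamma> \<gamma> = \<langle>\<gamma> | \<beta>\<rangle> * form \<beta> \<beta>"
  using form_root [OF assms(1), of \<gamma>] form_root [OF assms(2), of \<beta>] by (simp add: form_commute)

lemma root_in_span_simples:
  assumes "\<beta> \<in> roots D"
  shows "\<beta> \<in> Z.span (simples D)"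
proof -
  have *: "x \<in> Z.span (simples D)" if "nonneg_comb (simples D) x" for x
    using that unfolding nonneg_comb_def by (auto intro: Z.span_sum Z.span_scale Z.span_base)
  show ?thesis
    using roots_pos_or_neg [OF assms] * [of \<beta>] Z.span_neg [OF * [of "- \<beta>"]] by auto
qed

text \<open>This is \<open>v \<mapsto> (v, _)\<close> for the analogous form \<open>(v, w) = \<Sum>\<langle>\<alpha> | v\<rangle>\<langle>\<alpha> | w\<rangle>\<close> on the dual lattice. Up to nonzero
scalars, it maps each coroot to its root, and so inverts the map from roots to coroots.\<close>

definition dual_form_map :: "'m \<Rightarrow> 'l" where
  "dual_form_map v = (\<Sum>\<alpha>\<in>roots D. zscale (pairing D \<alpha> v) \<alpha>)"

lemma dual_form_map_add: "dual_form_map (v + w) = dual_form_map v + dual_form_map w"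
  by (simp add: dual_form_map_def pairing_linear zscale_add_left sum.distrib)

lemma dual_form_map_zscale: "dual_form_map (zscale k v) = zscale k (dual_form_map v)"
  by (simp add: dual_form_map_def pairing_linear Z.scale_sum_right)

lemma pairing_dual_form_map: "pairing D (dual_form_map v) v = (\<Sum>\<alpha>\<in>roots D. (pairing D \<alpha> v)\<^sup>2)"
  by (simp add: dual_form_map_def pairing_linear power2_eq_square)

text \<open>The map commutes with the reflection in \<open>\<beta>\<close>, so the image of \<open>\<beta>\<^sup>\<or>\<close> is negated by this reflection, and
hence is proportional to \<open>\<beta>\<close>.\<close>

lemma dual_form_map_coroot:
  assumes \<beta>: "\<beta> \<in> roots D"
  shows "\<exists>n>0. zscale 2 (dual_form_map (coroot D \<beta>)) = zscale n \<beta>"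
proof (intro exI conjI)
  let ?q = "dual_form_map (coroot D \<beta>)"
  let ?s = "reflection D \<beta>"
  have s_s: "?s (?s x) = x" for x
    using zscale_add_left [of "\<langle>x | \<beta>\<rangle>" "- \<langle>x | \<beta>\<rangle>" \<beta>] pairing_root_coroot [OF \<beta>]
    by (simp add: reflection_def pairing_linear)
  have s_pair: "\<langle>?s x | \<beta>\<rangle> = - \<langle>x | \<beta>\<rangle>" for x
    using pairing_root_coroot [OF \<beta>] by (simp add: reflection_def pairing_linear)
  have "?s ?q = (\<Sum>\<alpha>\<in>roots D. zscale \<langle>\<alpha> | \<beta>\<rangle> (?s \<alpha>))"
    by (simp add: reflection_def dual_form_map_def pairing_linear Z.scale_right_diff_distrib
        sum_subtractf Z.scale_sum_left)
  also have "\<dots> = (\<Sum>\<alpha>\<in>roots D. zscale \<langle>?s \<alpha> | \<beta>\<rangle> \<alpha>)"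
    by (rule sum.reindex_bij_witness [where i = ?s and j = ?s])
      (simp_all add: s_s reflection_root \<beta>)
  also have "\<dots> = - ?q"
    by (simp add: s_pair dual_form_map_def sum_negf)
  finally have "?s ?q = - ?q" .
  then have "?q + ?q = zscale \<langle>?q | \<beta>\<rangle> \<beta>"
    by (simp add: reflection_def algebra_simps eq_neg_iff_add_eq_0)
  then show "zscale 2 ?q = zscale \<langle>?q | \<beta>\<rangle> \<beta>"
    using zscale_add_left [of 1 1 ?q] by simp
  have "0 < (\<langle>\<beta> | \<beta>\<rangle>)\<^sup>2" by (simp add: pairing_root_coroot [OF \<beta>])
  also have "\<dots> \<le> \<langle>?q | \<beta>\<rangle>"
    unfolding pairing_dual_form_map by (rule member_le_sum) (use \<beta> finite_roots in auto)
  finally show "0 < \<langle>?q | \<beta>\<rangle>" .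
qed

text \<open>A multiple \<open>M z\<close> is the image of a combination \<open>v\<close> of coroots under \<open>dual_form_map\<close>. If \<open>(z, z) = 0\<close>
then \<open>z\<close> is orthogonal to all coroots, hence to \<open>v\<close>, so \<open>0 = \<langle>M z | v\<rangle> = \<Sum>\<langle>\<alpha> | v\<rangle>\<^sup>2\<close>. Thus \<open>v\<close> is orthogonal to
all roots, and its image \<open>M z\<close> is 0.\<close>

lemma form_nondegenerate:
  assumes z: "z \<in> Z.span (simples D)" and zz: "form z z = 0"
  shows "z = 0"
proof -
  have "\<exists>M>0. \<exists>v\<in>Z.span (coroot D ` roots D). zscale M z = dual_form_map v"
    using z
  proof (induction rule: Z.span_induct_alt)
    case base
    have "dual_form_map 0 = 0" by (simp add: dual_form_map_def)
    then show ?case using Z.span_zero by (metis Z.scale_zero_right zero_less_one)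
  next
    case (step c \<beta> y)
    from step obtain M v where M: "0 < M" and v: "v \<in> Z.span (coroot D ` roots D)"
      and Mv: "zscale M y = dual_form_map v" by auto
    have \<beta>: "\<beta> \<in> roots D" using step simple_root by auto
    obtain n where n: "0 < n" "zscale 2 (dual_form_map (coroot D \<beta>)) = zscale n \<beta>"
      using dual_form_map_coroot [OF \<beta>] by blast
    let ?w = "zscale (M * c * 2) (coroot D \<beta>) + zscale n v"
    have "zscale (M * n) (zscale c \<beta> + y) = zscale (M * c) (zscale n \<beta>) + zscale n (zscale M y)"
      by (simp add: Z.scale_right_distrib ac_simps)
    also have "\<dots> = dual_form_map ?w"
      by (simp only: n(2)[symmetric] Mv dual_form_map_add dual_form_map_zscale zscale_zscale)
    finally have "zscale (M * n) (zscale c \<beta> + y) = dual_form_map ?w" .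
    moreover have "?w \<in> Z.span (coroot D ` roots D)"
      using \<beta> v by (intro Z.span_add Z.span_scale) (auto intro: Z.span_base)
    moreover have "0 < M * n" using M n(1) by simp
    ultimately show ?case by blast
  qed
  then obtain M v where M: "0 < M" and v: "v \<in> Z.span (coroot D ` roots D)"
    and Mv: "zscale M z = dual_form_map v" by blast
  have z_perp: "pairing D z w = 0" if "w \<in> coroot D ` roots D" for w
    using zz that finite_roots sum_nonneg_eq_0_iff [of "coroot D ` roots D" "\<lambda>v. pairing D z v * pairing D z v"]
    by (auto simp: form_def)
  have "pairing D z v = 0"
    using v by (induction rule: Z.span_induct_alt) (auto simp: pairing_linear z_perp)
  then have "(\<Sum>\<alpha>\<in>roots D. (pairing D \<alpha> v)\<^sup>2) = 0"
    by (simp add: pairing_dual_form_map [symmetric] Mv [symmetric] pairing_linear)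
  then have "\<forall>\<alpha>\<in>roots D. pairing D \<alpha> v = 0"
    using finite_roots by (simp add: sum_nonneg_eq_0_iff)
  then have "dual_form_map v = 0" by (simp add: dual_form_map_def)
  then show ?thesis using Mv M by (simp add: zscale_eq_0_iff)
qed


section \<open>Coefficients with respect to the simple roots\<close>

abbreviation coeff :: "'l \<Rightarrow> 'l \<Rightarrow> int" where
  "coeff x \<equiv> Z.representation (simples D) x"

lemma simple_in_span: "\<alpha> \<in> simples D \<Longrightarrow> \<alpha> \<in> Z.span (simples D)"
  by (rule Z.span_base)

lemma coeff_add:
  "x \<in> Z.span (simples D) \<Longrightarrow> y \<in> Z.span (simples D) \<Longrightarrow> coeff (x + y) \<alpha> = coeff x \<alpha> + coeff y \<alpha>"
  by (simp add: Z.representation_add simples_independent)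

lemma coeff_diff:
  "x \<in> Z.span (simples D) \<Longrightarrow> y \<in> Z.span (simples D) \<Longrightarrow> coeff (x - y) \<alpha> = coeff x \<alpha> - coeff y \<alpha>"
  by (simp add: Z.representation_diff simples_independent)

lemma coeff_minus: "x \<in> Z.span (simples D) \<Longrightarrow> coeff (- x) \<alpha> = - coeff x \<alpha>"
  by (simp add: Z.representation_neg simples_independent)

lemma coeff_zscale: "x \<in> Z.span (simples D) \<Longrightarrow> coeff (zscale k x) \<alpha> = k * coeff x \<alpha>"
  by (simp add: Z.representation_scale simples_independent)

lemmas coeff_linear = coeff_add coeff_diff coeff_minus coeff_zscale

lemma coeff_simple: "\<alpha> \<in> simples D \<Longrightarrow> coeff \<alpha> \<beta> = of_bool (\<beta> = \<alpha>)"
  using Z.representation_basis [OF simples_independent, of \<alpha>] by simp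

lemma span_eqI:
  assumes x: "x \<in> Z.span (simples D)" and y: "y \<in> Z.span (simples D)"
    and "\<And>\<alpha>. \<alpha> \<in> simples D \<Longrightarrow> coeff x \<alpha> = coeff y \<alpha>"
  shows "x = y"
proof -
  have "x = (\<Sum>\<alpha>\<in>simples D. zscale (coeff x \<alpha>) \<alpha>)"
    using Z.sum_representation_eq [OF simples_independent x finite_simples] by simp
  also have "\<dots> = (\<Sum>\<alpha>\<in>simples D. zscale (coeff y \<alpha>) \<alpha>)"
    using assms(3) by simp
  also have "\<dots> = y"
    using Z.sum_representation_eq [OF simples_independent y finite_simples] by simp
  finally show ?thesis .
qed

lemma nonneg_comb_simple: "\<alpha> \<in> simples D \<Longrightarrow> nonneg_comb (simples D) \<alpha>"
  unfolding nonneg_comb_def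
  by (rule exI [of _ "\<lambda>\<beta>. of_bool (\<beta> = \<alpha>)"])
    (simp add: of_bool_def if_distrib [of "\<lambda>c. zscale c x" for x] finite_simples cong: if_cong)

lemma coeff_nonneg:
  assumes "nonneg_comb (simples D) x"
  shows "0 \<le> coeff x \<alpha>"
proof -
  obtain c where c: "\<forall>\<alpha>\<in>simples D. 0 \<le> c \<alpha>" "x = (\<Sum>\<alpha>\<in>simples D. zscale (c \<alpha>) \<alpha>)"
    using assms by (auto simp: nonneg_comb_def)
  have "coeff x \<alpha> = (\<Sum>\<beta>\<in>simples D. c \<beta> * coeff \<beta> \<alpha>)"
    unfolding c(2) using simples_independent
    by (simp add: Z.representation_sum Z.representation_scale Z.span_scale simple_in_span)
  also have "\<dots> \<ge> 0"
    by (intro sum_nonneg) (auto simp: c(1) coeff_simple)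
  finally show ?thesis .
qed

lemma positive_rootD:
  assumes "\<beta> \<in> positive_roots D"
  shows "\<beta> \<in> roots D" "0 \<le> coeff \<beta> \<alpha>"
  using assms coeff_nonneg by (auto simp: positive_roots_def)

lemma coeff_sum_enumeration:
  assumes "inj_on \<alpha> J" "\<alpha> ` J \<subseteq> simples D" "I \<subseteq> J" "finite I" "j \<in> J"
  shows "coeff (\<Sum>i\<in>I. \<alpha> i) (\<alpha> j) = of_bool (j \<in> I)"
proof -
  have "coeff (\<Sum>i\<in>I. \<alpha> i) (\<alpha> j) = (\<Sum>i\<in>I. coeff (\<alpha> i) (\<alpha> j))"
    using simples_independent assms by (subst Z.representation_sum) (auto intro: simple_in_span)
  also have "\<dots> = (\<Sum>i\<in>I. of_bool (i = j))"
  proof (rule sum.cong)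
    fix i assume "i \<in> I"
    then have "\<alpha> i \<in> simples D" "\<alpha> j = \<alpha> i \<longleftrightarrow> i = j"
      using assms inj_on_eq_iff [OF assms(1), of j i] by auto
    then show "coeff (\<alpha> i) (\<alpha> j) = of_bool (i = j)" by (simp add: coeff_simple)
  qed simp
  also have "\<dots> = of_bool (j \<in> I)" using assms(4) by (simp add: of_bool_def)
  finally show ?thesis .
qed

lemma coeff_eq_0_imp_span:
  assumes x: "x \<in> Z.span (simples D)" and "I \<subseteq> simples D"
    and "\<And>\<alpha>. \<alpha> \<in> simples D - I \<Longrightarrow> coeff x \<alpha> = 0"
  shows "x \<in> Z.span I"
proof -
  have "x = (\<Sum>\<alpha>\<in>simples D. zscale (coeff x \<alpha>) \<alpha>)"
    using Z.sum_representation_eq [OF simples_independent x finite_simples] by simp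
  also have "\<dots> = (\<Sum>\<alpha>\<in>I. zscale (coeff x \<alpha>) \<alpha>)"
    by (rule sum.mono_neutral_right) (use assms finite_simples in auto)
  also have "\<dots> \<in> Z.span I"
    by (intro Z.span_sum Z.span_scale Z.span_base)
  finally show ?thesis .
qed

text \<open>The cross terms are no obstacle: \<open>2(y, \<alpha>) = \<langle>y | \<alpha>\<rangle>(\<alpha>, \<alpha>)\<close> is an integral multiple of \<open>(\<alpha>, \<alpha>)\<close>.\<close>

lemma dvd_form_self:
  assumes "x \<in> Z.span I" "I \<subseteq> roots D" "\<And>\<alpha>. \<alpha> \<in> I \<Longrightarrow> N dvd form \<alpha> \<alpha>"
  shows "N dvd form x x"
  using assms(1)
proof (induction rule: Z.span_induct_alt)
  case base
  show ?case by (simp add: form_def)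
next
  case (step c \<alpha> y)
  have "form (zscale c \<alpha> + y) (zscale c \<alpha> + y) =
      c * c * form \<alpha> \<alpha> + c * (2 * form y \<alpha>) + form y y"
    by (simp add: form_linear form_commute [of \<alpha> y] algebra_simps)
  also have "2 * form y \<alpha> = \<langle>y | \<alpha>\<rangle> * form \<alpha> \<alpha>"
    using form_root step assms(2) by blast
  finally show ?case using step assms(3) by simp
qed

text \<open>Since \<open>2(x, \<beta>) / (\<beta>, \<beta>) = \<langle>x | \<beta>\<rangle>\<close> and the form is nondegenerate, a linear relation between coroots \<open>\<beta>\<^sup>\<or>\<close> is
equivalent to the same relation between the vectors \<open>\<beta> / (\<beta>, \<beta>)\<close>. The coefficients of these vectors
are rational, hence the statement in the reals.\<close>

lemma coeff_of_coroot_difference: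
  assumes roots: "\<beta>1 \<in> roots D" "\<beta>2 \<in> roots D" "\<delta>1 \<in> roots D" "\<delta>2 \<in> roots D"
    and eq: "coroot D \<beta>1 - coroot D \<beta>2 = coroot D \<delta>1 - coroot D \<delta>2"
  shows "coeff \<beta>1 \<alpha> / form \<beta>1 \<beta>1 - coeff \<beta>2 \<alpha> / form \<beta>2 \<beta>2 =
    real_of_int (coeff \<delta>1 \<alpha>) / form \<delta>1 \<delta>1 - coeff \<delta>2 \<alpha> / form \<delta>2 \<delta>2"
proof -
  define b1 b2 d1 d2 where
    "b1 = form \<beta>1 \<beta>1" "b2 = form \<beta>2 \<beta>2" "d1 = form \<delta>1 \<delta>1" "d2 = form \<delta>2 \<delta>2"
  note n = this
  note span = roots [THEN root_in_span_simples]
  \<comment> \<open>The difference of the two sides, multiplied by the common denominator; it is orthogonal to everything.\<close>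
  define z where "z = zscale (b2 * d1 * d2) \<beta>1 - zscale (b1 * d1 * d2) \<beta>2
    - (zscale (b1 * b2 * d2) \<delta>1 - zscale (b1 * b2 * d1) \<delta>2)"
  have z: "z \<in> Z.span (simples D)"
    unfolding z_def using span by (intro Z.span_diff Z.span_scale)
  let ?v = "coroot D \<beta>1 - coroot D \<beta>2 - (coroot D \<delta>1 - coroot D \<delta>2)"
  have "2 * form x z = b1 * b2 * d1 * d2 * pairing D x ?v" for x
  proof -
    have "2 * form x z = b2 * d1 * d2 * (2 * form x \<beta>1) - b1 * d1 * d2 * (2 * form x \<beta>2)
        - (b1 * b2 * d2 * (2 * form x \<delta>1) - b1 * b2 * d1 * (2 * form x \<delta>2))"
      unfolding z_def by (simp add: form_linear algebra_simps)
    also have "\<dots> = b1 * b2 * d1 * d2 * pairing D x ?v"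
      unfolding form_root [OF roots(1)] form_root [OF roots(2)] form_root [OF roots(3)] form_root [OF roots(4)]
      by (simp add: n [symmetric] pairing_linear algebra_simps)
    finally show ?thesis .
  qed
  from this [of z] have "form z z = 0" unfolding eq by simp
  with z have "z = 0" by (rule form_nondegenerate)
  then have "coeff z \<alpha> = 0" by (simp add: Z.representation_zero)
  then have "b2 * d1 * d2 * coeff \<beta>1 \<alpha> - b1 * d1 * d2 * coeff \<beta>2 \<alpha> -
      (b1 * b2 * d2 * coeff \<delta>1 \<alpha> - b1 * b2 * d1 * coeff \<delta>2 \<alpha>) = 0"
    using span by (simp add: z_def coeff_linear Z.span_diff Z.span_scale)
  then have "real_of_int (b2 * d1 * d2 * coeff \<beta>1 \<alpha> - b1 * d1 * d2 * coeff \<beta>2 \<alpha> -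
      (b1 * b2 * d2 * coeff \<delta>1 \<alpha> - b1 * b2 * d1 * coeff \<delta>2 \<alpha>)) = 0" by simp
  moreover have "b1 > 0" "b2 > 0" "d1 > 0" "d2 > 0"
    using roots [THEN form_root_pos] by (simp_all add: n)
  ultimately show ?thesis
    unfolding n [symmetric] by (simp add: field_simps)
qed


section \<open>Orthogonal pairs of roots\<close>

text \<open>The multiplier divides \<open>2 = \<langle>\<beta> | \<beta>\<^sup>\<or>\<rangle>\<close>, and \<open>\<plusminus>2\<close> is impossible in a reduced root system.\<close>

lemma root_zscale_imp:
  assumes "\<beta> \<in> roots D" "\<gamma> \<in> roots D" "\<beta> = zscale k \<gamma>"
  shows "k = 1 \<or> k = - 1"
proof -
  have "2 = k * \<langle>\<gamma> | \<beta>\<rangle>"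
    using pairing_root_coroot [OF assms(1)] arg_cong [OF assms(3), of "\<lambda>x. \<langle>x | \<beta>\<rangle>"]
    by (simp add: pairing_linear)
  then have "k dvd 2" by (metis dvd_triv_left)
  then have "\<bar>k\<bar> \<le> 2" using dvd_imp_le_int [of 2 k] by simp
  moreover have "k \<noteq> 0" using root_nonzero [OF assms(1)] assms(3) by auto
  moreover have "k \<noteq> 2" using assms reduced by auto
  moreover have "k \<noteq> - 2" using assms reduced uminus_root [of \<beta>] by auto
  ultimately show ?thesis by linarith
qed

lemma rat_span2_reflection: "reflection D \<gamma>2 \<gamma>1 \<in> rat_span2 \<gamma>1 \<gamma>2"
  using rat_span2I [of 1 \<gamma>1 "- \<langle>\<gamma>1 | \<gamma>2\<rangle>" \<gamma>2] by (simp add: reflection_def)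

text \<open>The reflection of \<open>\<gamma>1\<close> in \<open>\<gamma>2\<close> is one of the four roots in the span. It is \<open>\<gamma>1\<close> if the two roots are
orthogonal; in every other case they would be proportional.\<close>

lemma rat_span2_imp_orthogonal:
  assumes \<gamma>: "\<gamma>1 \<in> roots D" "\<gamma>2 \<in> roots D" and ne: "\<gamma>1 \<noteq> \<gamma>2" "\<gamma>1 \<noteq> - \<gamma>2"
    and span: "rat_span2 \<gamma>1 \<gamma>2 \<inter> roots D = {\<gamma>1, - \<gamma>1, \<gamma>2, - \<gamma>2}"
  shows "form \<gamma>1 \<gamma>2 = 0"
proof -
  define n where "n = \<langle>\<gamma>1 | \<gamma>2\<rangle>"
  have not_multiple: "\<gamma>1 \<noteq> zscale k \<gamma>2" for k
    using root_zscale_imp [OF \<gamma>, of k] ne by auto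
  have "reflection D \<gamma>2 \<gamma>1 \<in> {\<gamma>1, - \<gamma>1, \<gamma>2, - \<gamma>2}"
    using rat_span2_reflection reflection_root \<gamma> span by auto
  then consider "\<gamma>1 - zscale n \<gamma>2 = \<gamma>1" | "\<gamma>1 - zscale n \<gamma>2 = - \<gamma>1"
    | "\<gamma>1 = zscale (n + 1) \<gamma>2" | "\<gamma>1 = zscale (n - 1) \<gamma>2"
    by (auto simp: reflection_def n_def [symmetric] zscale_succ zscale_pred algebra_simps)
  then have "n = 0"
  proof cases
    case 1
    then show ?thesis using root_nonzero \<gamma> by (simp add: zscale_eq_0_iff)
  next
    case 2
    then have eq: "zscale 2 \<gamma>1 = zscale n \<gamma>2"
      using zscale_add_left [of 1 1 \<gamma>1] by (simp add: algebra_simps eq_neg_iff_add_eq_0)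
    \<comment> \<open>So \<open>n\<close> divides 4. An even \<open>n\<close> would make \<open>\<gamma>1\<close> a multiple of \<open>\<gamma>2\<close>, and \<open>n = \<plusminus>1\<close> means \<open>\<gamma>2 = \<plusminus>2 \<gamma>1\<close>.\<close>
    have "4 = n * \<langle>\<gamma>2 | \<gamma>1\<rangle>"
      using arg_cong [OF eq, of "\<lambda>x. \<langle>x | \<gamma>1\<rangle>"] \<gamma> by (simp add: pairing_linear pairing_root_coroot)
    then have "n dvd 4" by (metis dvd_triv_left)
    moreover have "\<not> even n"
    proof
      assume "even n"
      then obtain k where "n = 2 * k" by blast
      then have "zscale 2 \<gamma>1 = zscale 2 (zscale k \<gamma>2)" using eq by simp
      then have "\<gamma>1 = zscale k \<gamma>2" by (metis zscale_cancel zero_neq_numeral)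
      then show False using not_multiple by blast
    qed
    ultimately have "\<bar>n\<bar> \<le> 4" "odd n" "\<not> 3 dvd n"
      using dvd_trans [of 3 n 4] dvd_imp_le_int [of 4 n] by auto
    then have "\<bar>n\<bar> = 1 \<or> \<bar>n\<bar> = 3" by presburger
    then have "n = 1 \<or> n = - 1" using \<open>\<not> 3 dvd n\<close> by presburger
    then have "\<gamma>2 = zscale 2 \<gamma>1 \<or> \<gamma>2 = zscale (- 2) \<gamma>1" using eq by auto
    then show ?thesis
      using root_zscale_imp [OF \<gamma>(2,1), of 2] root_zscale_imp [OF \<gamma>(2,1), of "- 2"] by auto
  qed (use not_multiple in auto)
  then show ?thesis using form_root [OF \<gamma>(2), of \<gamma>1] by (simp add: n_def)
qed

lemma form_0_imp_pairing_0:
  assumes "\<beta> \<in> roots D" "form x \<beta> = 0"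
  shows "\<langle>x | \<beta>\<rangle> = 0"
  using form_root [OF assms(1), of x] form_root_pos [OF assms(1)] assms(2) by simp

text \<open>The assumptions on the coefficients say that \<open>\<gamma>1\<close> and \<open>\<gamma>2\<close> are part of a basis of the root lattice,
so a root \<open>\<beta>\<close> in their rational span is an integral combination \<open>p \<gamma>1 + q \<gamma>2\<close>. In
\<open>2 = \<langle>\<beta> | \<beta>\<rangle> = p \<langle>\<gamma>1 | \<beta>\<rangle> + q \<langle>\<gamma>2 | \<beta>\<rangle>\<close> a summand with a nonzero factor \<open>p\<close> or \<open>q\<close> is positive, by orthogonality. So
if both are nonzero then \<open>p, q = \<plusminus>1\<close>. This is excluded because \<open>\<gamma>1 + \<gamma>2\<close> is not a root, and neither is
its reflection \<open>\<gamma>1 - \<gamma>2\<close>.\<close>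

lemma rat_span2_roots_eq:
  assumes \<gamma>: "\<gamma>1 \<in> roots D" "\<gamma>2 \<in> roots D" and orth: "form \<gamma>1 \<gamma>2 = 0"
    and sum: "\<gamma>1 + \<gamma>2 \<notin> roots D"
    and primitive: "coeff \<gamma>1 \<alpha>1 = 1" "coeff \<gamma>2 \<alpha>1 = 0" "coeff \<gamma>2 \<alpha>2 = 1"
  shows "rat_span2 \<gamma>1 \<gamma>2 \<inter> roots D = {\<gamma>1, - \<gamma>1, \<gamma>2, - \<gamma>2}"
proof
  show "{\<gamma>1, - \<gamma>1, \<gamma>2, - \<gamma>2} \<subseteq> rat_span2 \<gamma>1 \<gamma>2 \<inter> roots D"
    using \<gamma> uminus_root rat_span2I [of 1 \<gamma>1 0 \<gamma>2] rat_span2I [of "- 1" \<gamma>1 0 \<gamma>2]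
      rat_span2I [of 0 \<gamma>1 1 \<gamma>2] rat_span2I [of 0 \<gamma>1 "- 1" \<gamma>2] by simp
  note span = \<gamma> [THEN root_in_span_simples]
  have orth': "\<langle>\<gamma>1 | \<gamma>2\<rangle> = 0" "\<langle>\<gamma>2 | \<gamma>1\<rangle> = 0"
    using form_0_imp_pairing_0 \<gamma> orth form_commute [of \<gamma>1 \<gamma>2] by simp_all
  have diff: "\<gamma>1 - \<gamma>2 \<notin> roots D"
  proof
    assume "\<gamma>1 - \<gamma>2 \<in> roots D"
    then have "reflection D \<gamma>2 (\<gamma>1 - \<gamma>2) \<in> roots D" using reflection_root \<gamma> by blast
    then show False
      using sum zscale_add_left [of 1 1 \<gamma>2]
      by (simp add: reflection_def pairing_linear orth' pairing_root_coroot \<gamma>)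
  qed
  show "rat_span2 \<gamma>1 \<gamma>2 \<inter> roots D \<subseteq> {\<gamma>1, - \<gamma>1, \<gamma>2, - \<gamma>2}"
  proof
    fix \<beta> assume "\<beta> \<in> rat_span2 \<gamma>1 \<gamma>2 \<inter> roots D"
    then obtain k a b where \<beta>: "\<beta> \<in> roots D" and k: "k \<noteq> 0"
      and eq: "zscale k \<beta> = zscale a \<gamma>1 + zscale b \<gamma>2"
      by (auto simp: rat_span2_def)
    have \<beta>_span: "\<beta> \<in> Z.span (simples D)" using root_in_span_simples \<beta> .
    have coeff_eq: "k * coeff \<beta> \<alpha> = a * coeff \<gamma>1 \<alpha> + b * coeff \<gamma>2 \<alpha>" for \<alpha>
      using arg_cong [OF eq, of "\<lambda>x. coeff x \<alpha>"] span \<beta>_span by (simp add: coeff_linear Z.span_scale)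
    define p where "p = coeff \<beta> \<alpha>1"
    define q where "q = coeff \<beta> \<alpha>2 - p * coeff \<gamma>1 \<alpha>2"
    have "a = k * p" "b = k * q"
      using coeff_eq [of \<alpha>1] coeff_eq [of \<alpha>2] primitive by (simp_all add: p_def q_def algebra_simps)
    then have "zscale k \<beta> = zscale k (zscale p \<gamma>1 + zscale q \<gamma>2)"
      using eq by (simp add: Z.scale_right_distrib)
    then have \<beta>_eq: "\<beta> = zscale p \<gamma>1 + zscale q \<gamma>2" using k by (simp add: zscale_cancel)
    have pos: "0 < k * \<langle>\<gamma> | \<beta>\<rangle>"
      if "k \<noteq> 0" and "\<gamma> \<in> roots D" and "form \<gamma> \<beta> = k * form \<gamma> \<gamma>" for k \<gamma>
    proof -
      have square: "0 < 2 * (k * k)" using that(1) by (auto simp: zero_less_mult_iff)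
      have "k * \<langle>\<gamma> | \<beta>\<rangle> * form \<beta> \<beta> = k * (2 * form \<gamma> \<beta>)" using form_root [OF \<beta>] by simp
      also have "\<dots> = 2 * (k * k) * form \<gamma> \<gamma>" using that by simp
      also have "\<dots> > 0"
        using square form_root_pos [OF that(2)] by (rule mult_pos_pos)
      finally show ?thesis using form_root_pos [OF \<beta>] by (simp add: zero_less_mult_iff)
    qed
    have p: "0 < p * \<langle>\<gamma>1 | \<beta>\<rangle>" if "p \<noteq> 0"
      using that \<gamma>(1) by (rule pos) (simp add: \<beta>_eq form_linear orth)
    have q: "0 < q * \<langle>\<gamma>2 | \<beta>\<rangle>" if "q \<noteq> 0"
      using that \<gamma>(2) by (rule pos) (simp add: \<beta>_eq form_linear orth form_commute [of \<gamma>2 \<gamma>1])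
    have "2 = \<langle>\<beta> | \<beta>\<rangle>" using pairing_root_coroot [OF \<beta>] by simp
    also have "\<dots> = p * \<langle>\<gamma>1 | \<beta>\<rangle> + q * \<langle>\<gamma>2 | \<beta>\<rangle>"
      using arg_cong [OF \<beta>_eq, of "\<lambda>x. \<langle>x | \<beta>\<rangle>"] by (simp add: pairing_linear)
    finally have two: "p * \<langle>\<gamma>1 | \<beta>\<rangle> + q * \<langle>\<gamma>2 | \<beta>\<rangle> = 2" ..
    consider "p = 0" | "q = 0" | "p \<noteq> 0" "q \<noteq> 0" by blast
    then show "\<beta> \<in> {\<gamma>1, - \<gamma>1, \<gamma>2, - \<gamma>2}"
    proof cases
      case 1
      then show ?thesis using root_zscale_imp [OF \<beta> \<gamma>(2), of q] \<beta>_eq by auto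
    next
      case 2
      then show ?thesis using root_zscale_imp [OF \<beta> \<gamma>(1), of p] \<beta>_eq by auto
    next
      case 3
      then have "p * \<langle>\<gamma>1 | \<beta>\<rangle> = 1" "q * \<langle>\<gamma>2 | \<beta>\<rangle> = 1" using p q two by auto
      then have "p = 1 \<or> p = - 1" "q = 1 \<or> q = - 1" by (auto simp: zmult_eq_1_iff)
      then have "\<beta> = \<gamma>1 + \<gamma>2 \<or> - \<beta> = \<gamma>1 + \<gamma>2 \<or> \<beta> = \<gamma>1 - \<gamma>2 \<or> - \<beta> = \<gamma>1 - \<gamma>2"
        using \<beta>_eq by auto
      then show ?thesis using sum diff \<beta> uminus_root by metis
    qed
  qed
qed

text \<open>For the criterion on the rational span it remains to supply two simple roots that witness primitivity.\<close>

lemma associated_pairI: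
  assumes \<gamma>: "\<gamma>1 \<in> roots D" "\<gamma>2 \<in> roots D"
    and nonneg: "nonneg_comb (simples D) \<gamma>1" "nonneg_comb (simples D) \<gamma>2"
    and orth: "form \<gamma>1 \<gamma>2 = 0"
    and sum: "\<gamma>1 + \<gamma>2 \<notin> roots D"
    and primitive: "coeff \<gamma>1 \<alpha>1 = 1" "coeff \<gamma>2 \<alpha>1 = 0" "coeff \<gamma>2 \<alpha>2 = 1"
    and \<delta>: "\<delta>1 \<in> simples D" "\<delta>2 \<in> simples D"
      "coroot D \<gamma>1 - coroot D \<gamma>2 = coroot D \<delta>1 - coroot D \<delta>2"
  shows "associated_pair D (\<gamma>1 + \<gamma>2) {\<gamma>1, \<gamma>2}"
  unfolding associated_pair_def
proof (intro exI conjI)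
  show "{\<gamma>1, \<gamma>2} \<subseteq> positive_roots D" using \<gamma> nonneg by (simp add: positive_roots_def)
  show "rat_span2 \<gamma>1 \<gamma>2 \<inter> roots D = {\<gamma>1, - \<gamma>1, \<gamma>2, - \<gamma>2}"
    by (rule rat_span2_roots_eq) fact+
  show "\<exists>\<delta>1\<in>simples D. \<exists>\<delta>2\<in>simples D. coroot D \<gamma>1 - coroot D \<gamma>2 = coroot D \<delta>1 - coroot D \<delta>2"
    using \<delta> by blast
qed (rule refl)+

text \<open>Multiplied by the norm of \<open>\<gamma>1\<close>, the coroots of \<open>\<gamma>1\<close>, \<open>\<gamma>2\<close> become \<open>2 (_, \<gamma>1)\<close> and \<open>2 r (_, \<gamma>2)\<close>.\<close>

lemma coroot_difference_eqI:
  assumes \<gamma>: "\<gamma>1 \<in> roots D" "\<gamma>2 \<in> roots D" and \<delta>: "\<delta>1 \<in> roots D" "\<delta>2 \<in> roots D"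
    and norms: "form \<gamma>1 \<gamma>1 = r * form \<gamma>2 \<gamma>2" "form \<delta>1 \<delta>1 = r * form \<gamma>2 \<gamma>2"
      "form \<delta>2 \<delta>2 = r * form \<gamma>2 \<gamma>2"
    and diff: "\<gamma>1 - zscale r \<gamma>2 = \<delta>1 - \<delta>2"
  shows "coroot D \<gamma>1 - coroot D \<gamma>2 = coroot D \<delta>1 - coroot D \<delta>2"
proof (rule coroot_eqI)
  fix x
  let ?n = "r * form \<gamma>2 \<gamma>2"
  have "?n * pairing D x (coroot D \<gamma>1 - coroot D \<gamma>2) = 2 * form x \<gamma>1 - r * (2 * form x \<gamma>2)"
    unfolding form_root [OF \<gamma>(1)] form_root [OF \<gamma>(2)] norms
    by (simp add: pairing_linear algebra_simps)
  also have "\<dots> = 2 * form x (\<gamma>1 - zscale r \<gamma>2)" by (simp add: form_linear)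
  also have "\<dots> = 2 * form x \<delta>1 - 2 * form x \<delta>2" unfolding diff by (simp add: form_linear)
  also have "\<dots> = ?n * pairing D x (coroot D \<delta>1 - coroot D \<delta>2)"
    unfolding form_root [OF \<delta>(1)] form_root [OF \<delta>(2)] norms
    by (simp add: pairing_linear algebra_simps)
  finally show "pairing D x (coroot D \<gamma>1 - coroot D \<gamma>2) = pairing D x (coroot D \<delta>1 - coroot D \<delta>2)"
    using form_root_pos [OF \<gamma>(1)] norms(1) by auto
qed

text \<open>The converse of the previous lemma, with unknown simple roots \<open>\<delta>1\<close>, \<open>\<delta>2\<close> on the coroot side. The
coefficients of \<open>\<gamma>1 - r \<gamma>2\<close> vanish outside \<open>{\<delta>1, \<delta>2}\<close>. They do not vanish at \<open>d1\<close> and \<open>d2\<close>: the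
coefficient of \<open>\<gamma>1 + \<gamma>2\<close> would be \<open>r + 1\<close> times that of \<open>\<gamma>2\<close>. This identifies the two sets; only the order
stays undetermined. The lemma is used with \<open>r = 1\<close> for \<open>D\<^sub>n\<close> and with \<open>r = 2\<close> for \<open>B\<^sub>3\<close>.\<close>

lemma coroot_difference_eqD:
  assumes \<gamma>: "\<gamma>1 \<in> roots D" "\<gamma>2 \<in> roots D"
    and d: "d1 \<in> simples D" "d2 \<in> simples D" "d1 \<noteq> d2"
    and \<delta>: "\<delta>1 \<in> simples D" "\<delta>2 \<in> simples D"
    and norms: "form \<gamma>1 \<gamma>1 = r * form \<gamma>2 \<gamma>2" "form d1 d1 = r * form \<gamma>2 \<gamma>2"
      "form d2 d2 = r * form \<gamma>2 \<gamma>2"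
    and not_dvd: "\<not> (r + 1) dvd coeff (\<gamma>1 + \<gamma>2) d1" "\<not> (r + 1) dvd coeff (\<gamma>1 + \<gamma>2) d2"
    and eq: "coroot D \<gamma>1 - coroot D \<gamma>2 = coroot D \<delta>1 - coroot D \<delta>2"
  shows "\<gamma>1 - zscale r \<gamma>2 = d1 - d2 \<or> \<gamma>1 - zscale r \<gamma>2 = d2 - d1"
proof -
  note span = \<gamma> [THEN root_in_span_simples] d(1,2) [THEN simple_in_span] \<delta> [THEN simple_in_span]
  let ?c = "\<lambda>\<alpha>. coeff \<gamma>1 \<alpha> - r * coeff \<gamma>2 \<alpha>"
  define n where "n = r * form \<gamma>2 \<gamma>2"
  have n: "0 < n" "0 < form \<gamma>2 \<gamma>2" "r \<noteq> 0"
    using form_root_pos [OF \<gamma>(1)] form_root_pos [OF \<gamma>(2)] norms(1) by (auto simp: n_def)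
  have rel: "real_of_int (?c \<alpha>) / n =
      of_bool (\<alpha> = \<delta>1) / form \<delta>1 \<delta>1 - of_bool (\<alpha> = \<delta>2) / form \<delta>2 \<delta>2" for \<alpha>
  proof -
    have "real_of_int (?c \<alpha>) / n = coeff \<gamma>1 \<alpha> / form \<gamma>1 \<gamma>1 - coeff \<gamma>2 \<alpha> / form \<gamma>2 \<gamma>2"
      using n unfolding norms n_def by (simp add: field_simps)
    then show ?thesis
      using coeff_of_coroot_difference [OF \<gamma> simple_root [OF \<delta>(1)] simple_root [OF \<delta>(2)] eq, of \<alpha>]
      by (simp add: coeff_simple \<delta>)
  qed
  have c_nonzero: "?c \<alpha> \<noteq> 0" if "\<not> (r + 1) dvd coeff (\<gamma>1 + \<gamma>2) \<alpha>" for \<alpha>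
  proof
    assume "?c \<alpha> = 0"
    then have "coeff (\<gamma>1 + \<gamma>2) \<alpha> = (r + 1) * coeff \<gamma>2 \<alpha>"
      using span by (simp add: coeff_linear algebra_simps)
    with that show False by simp
  qed
  have "\<alpha> = \<delta>1 \<or> \<alpha> = \<delta>2" if "?c \<alpha> \<noteq> 0" for \<alpha>
  proof (rule ccontr)
    assume "\<not> (\<alpha> = \<delta>1 \<or> \<alpha> = \<delta>2)"
    then have "real_of_int (?c \<alpha>) / n = 0" using rel [of \<alpha>] by simp
    then have "real_of_int (?c \<alpha>) = 0" using n by (simp del: of_int_diff)
    then show False using that by (simp del: of_int_diff)
  qed
  with c_nonzero not_dvd d(3) have "\<delta>1 = d1 \<and> \<delta>2 = d2 \<or> \<delta>1 = d2 \<and> \<delta>2 = d1" by metis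
  then have \<delta>_eq: "\<delta>1 = d1 \<and> \<delta>2 = d2 \<or> \<delta>1 = d2 \<and> \<delta>2 = d1"
    and "form \<delta>1 \<delta>1 = n" "form \<delta>2 \<delta>2 = n" using norms by (auto simp: n_def)
  with rel have "real_of_int (?c \<alpha>) / n = (of_bool (\<alpha> = \<delta>1) - of_bool (\<alpha> = \<delta>2)) / n" for \<alpha>
    by (simp add: diff_divide_distrib)
  then have "real_of_int (?c \<alpha>) = of_bool (\<alpha> = \<delta>1) - of_bool (\<alpha> = \<delta>2)" for \<alpha>
    using n by simp
  then have "real_of_int (?c \<alpha>) = real_of_int (of_bool (\<alpha> = \<delta>1) - of_bool (\<alpha> = \<delta>2))" for \<alpha>
    by simp
  then have c: "?c \<alpha> = of_bool (\<alpha> = \<delta>1) - of_bool (\<alpha> = \<delta>2)" for \<alpha>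
    unfolding of_int_eq_iff .
  have "\<gamma>1 - zscale r \<gamma>2 = \<delta>1 - \<delta>2"
  proof (rule span_eqI)
    show "\<gamma>1 - zscale r \<gamma>2 \<in> Z.span (simples D)" "\<delta>1 - \<delta>2 \<in> Z.span (simples D)"
      using span by (simp_all add: Z.span_diff Z.span_scale)
    show "coeff (\<gamma>1 - zscale r \<gamma>2) \<alpha> = coeff (\<delta>1 - \<delta>2) \<alpha>" for \<alpha>
      using span c [of \<alpha>] by (simp add: coeff_linear Z.span_scale coeff_simple \<delta>)
  qed
  then show ?thesis using \<delta>_eq by auto
qed


section \<open>The rows of the table\<close>

lemma add_root:
  assumes "\<beta> \<in> roots D" "\<gamma> \<in> roots D" "\<langle>\<gamma> | \<beta>\<rangle> = - 1"
  shows "\<gamma> + \<beta> \<in> roots D" "form (\<gamma> + \<beta>) (\<gamma> + \<beta>) = form \<gamma> \<gamma>"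
proof -
  have "reflection D \<beta> \<gamma> = \<gamma> + \<beta>" using assms(3) by (simp add: reflection_def)
  then show "\<gamma> + \<beta> \<in> roots D" "form (\<gamma> + \<beta>) (\<gamma> + \<beta>) = form \<gamma> \<gamma>"
    using reflection_root [OF assms(1,2)] form_reflection [OF assms(1), of \<gamma> \<gamma>] by simp_all
qed

text \<open>The sum is built from its last term \<open>\<alpha> b\<close> downwards, each step being a simple reflection. Going down
means that only the numbers \<open>\<langle>\<alpha> (i + 1) | \<alpha> i\<rangle>\<close> matter, and these are \<open>- 1\<close> even for a double edge
ending in a short root \<open>\<alpha> b\<close>, as in type \<open>B\<close>.\<close>

lemma path_sum_root:
  assumes "a \<le> b" and roots: "\<And>i. a \<le> i \<Longrightarrow> i \<le> b \<Longrightarrow> \<alpha> i \<in> roots D"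
    and adjacent: "\<And>i. a \<le> i \<Longrightarrow> i < b \<Longrightarrow> \<langle>\<alpha> (Suc i) | \<alpha> i\<rangle> = - 1"
    and distant: "\<And>i j. a \<le> i \<Longrightarrow> Suc i < j \<Longrightarrow> j \<le> b \<Longrightarrow> \<langle>\<alpha> j | \<alpha> i\<rangle> = 0"
  shows "(\<Sum>i=a..b. \<alpha> i) \<in> roots D \<and>
    form (\<Sum>i=a..b. \<alpha> i) (\<Sum>i=a..b. \<alpha> i) = form (\<alpha> b) (\<alpha> b)"
  using assms(1)
proof (induction rule: inc_induct)
  case base
  show ?case using roots assms(1) by simp
next
  case (step n)
  let ?x = "\<Sum>i=Suc n..b. \<alpha> i"
  have "\<langle>?x | \<alpha> n\<rangle> = \<langle>\<alpha> (Suc n) | \<alpha> n\<rangle> + (\<Sum>i=Suc (Suc n)..b. \<langle>\<alpha> i | \<alpha> n\<rangle>)"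
    using step by (simp add: pairing_linear sum.atLeast_Suc_atMost)
  also have "\<dots> = - 1" using step adjacent distant by (simp add: sum.neutral)
  finally have "\<langle>?x | \<alpha> n\<rangle> = - 1" .
  moreover have "(\<Sum>i=n..b. \<alpha> i) = ?x + \<alpha> n"
    using step by (simp add: sum.atLeast_Suc_atMost add.commute)
  ultimately show ?case
    using step roots add_root [of "\<alpha> n" ?x] by simp
qed

definition diagram :: "dynkin \<Rightarrow> (nat \<Rightarrow> 'l) \<Rightarrow> bool" where
  "diagram X \<alpha> \<longleftrightarrow>
    inj_on \<alpha> {1..dynkin_rank X} \<and> \<alpha> ` {1..dynkin_rank X} \<subseteq> simples D \<and>
    (\<forall>i\<in>{1..dynkin_rank X}. \<forall>j\<in>{1..dynkin_rank X}. \<langle>\<alpha> i | \<alpha> j\<rangle> = cartan X i j)"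

lemma diagramD:
  assumes "diagram X \<alpha>" "1 \<le> i" "i \<le> dynkin_rank X"
  shows "\<alpha> i \<in> simples D" "\<alpha> i \<in> roots D"
    "1 \<le> j \<Longrightarrow> j \<le> dynkin_rank X \<Longrightarrow> \<langle>\<alpha> i | \<alpha> j\<rangle> = cartan X i j"
    "1 \<le> j \<Longrightarrow> j \<le> dynkin_rank X \<Longrightarrow> \<alpha> i = \<alpha> j \<longleftrightarrow> i = j"
  using assms simples_subset by (auto simp: diagram_def inj_on_eq_iff subset_iff)

lemma type_A_or_B_root:
  assumes "diagram (Type_A n) \<alpha> \<or> diagram (Type_B n) \<alpha>" "1 \<le> n"
  shows "(\<Sum>i=1..n. \<alpha> i) \<in> roots D"
  using assms
  by (intro path_sum_root [THEN conjunct1]) (auto simp: diagramD path_cartan_def)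

text \<open>This is the root \<open>e\<^sub>1 + e\<^sub>2\<close>. It is obtained from \<open>e\<^sub>1 - e\<^sub>n = \<alpha>\<^sub>1 + \<dots> + \<alpha>\<^sub>n\<^sub>-\<^sub>1\<close> by the reflections in
\<open>\<alpha>\<^sub>n, \<alpha>\<^sub>n\<^sub>-\<^sub>1, \<dots>, \<alpha>\<^sub>2\<close>, which lead through \<open>e\<^sub>1 + e\<^sub>n, e\<^sub>1 + e\<^sub>n\<^sub>-\<^sub>1, \<dots>\<close>\<close>

lemma type_C_root:
  assumes \<alpha>: "diagram (Type_C n) \<alpha>" and n: "3 \<le> n"
  shows "(\<Sum>i=1..n. zscale (if i = 1 \<or> i = n then 1 else 2) (\<alpha> i)) \<in> roots D"
proof -
  have rank: "dynkin_rank (Type_C n) = n" by simp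
  let ?p = "\<Sum>i=1..n-1. \<alpha> i"
  have pairing_p: "\<langle>?p | \<alpha> j\<rangle> = (\<Sum>i=1..n-1. path_cartan i j)" if "1 \<le> j" "j \<le> n" for j
    unfolding pairing_sum_left
    using that by (intro sum.cong) (auto simp: diagramD [OF \<alpha>])
  have p: "?p \<in> roots D"
    using n by (intro path_sum_root [THEN conjunct1]) (auto simp: diagramD [OF \<alpha>] path_cartan_def)
  have "2 \<le> n" using n by simp
  then have "?p + (\<Sum>i=2..n. \<alpha> i) \<in> roots D"
  proof (induction rule: inc_induct)
    case base
    have "\<langle>?p | \<alpha> n\<rangle> = - 1" using n pairing_p [of n] by (simp add: path_cartan_sum)
    then show ?case using n p add_root(1) [of "\<alpha> n" ?p] by (simp add: diagramD [OF \<alpha>])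
  next
    case (step k)
    let ?q = "\<Sum>i=Suc k..n. \<alpha> i"
    have "\<langle>?q | \<alpha> k\<rangle> = \<langle>\<alpha> (Suc k) | \<alpha> k\<rangle> + (\<Sum>i=Suc (Suc k)..n. \<langle>\<alpha> i | \<alpha> k\<rangle>)"
      using step by (simp add: pairing_linear sum.atLeast_Suc_atMost)
    also have "(\<Sum>i=Suc (Suc k)..n. \<langle>\<alpha> i | \<alpha> k\<rangle>) = 0"
      using step by (intro sum.neutral) (auto simp: diagramD [OF \<alpha>] path_cartan_def)
    finally have "\<langle>?q | \<alpha> k\<rangle> = (if Suc k = n then - 2 else - 1)"
      using step by (auto simp: diagramD [OF \<alpha>] path_cartan_def)
    moreover have "\<langle>?p | \<alpha> k\<rangle> = (if Suc k = n then 1 else 0)"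
      using step n pairing_p [of k] by (auto simp: path_cartan_sum)
    ultimately have "\<langle>?p + ?q | \<alpha> k\<rangle> = - 1"
      by (simp add: pairing_add_left)
    moreover have "(\<Sum>i=k..n. \<alpha> i) = ?q + \<alpha> k"
      using step by (simp add: sum.atLeast_Suc_atMost add.commute)
    ultimately show ?case
      using step add_root(1) [of "\<alpha> k" "?p + ?q"] by (simp add: diagramD [OF \<alpha>] add.assoc)
  qed
  also have "?p = (\<Sum>i=1..n. zscale (if i \<le> n - 1 then 1 else 0) (\<alpha> i))"
    by (rule sum.mono_neutral_cong_left) auto
  also have "(\<Sum>i=2..n. \<alpha> i) = (\<Sum>i=1..n. zscale (if 2 \<le> i then 1 else 0) (\<alpha> i))"
    by (rule sum.mono_neutral_cong_left) auto
  also have "(\<Sum>i=1..n. zscale (if i \<le> n - 1 then 1 else 0) (\<alpha> i)) +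
      (\<Sum>i=1..n. zscale (if 2 \<le> i then 1 else 0) (\<alpha> i)) =
      (\<Sum>i=1..n. zscale (if i = 1 \<or> i = n then 1 else 2) (\<alpha> i))"
    unfolding sum.distrib [symmetric] zscale_add_left [symmetric]
    using n by (intro sum.cong) auto
  finally show ?thesis .
qed

text \<open>The highest short root, reached from \<open>\<alpha>\<^sub>3\<close> by simple reflections that each add a single simple root.\<close>

lemma type_F4_root:
  assumes \<alpha>: "diagram Type_F4 \<alpha>"
  shows "(\<Sum>i=1..4. zscale ([1, 2, 3, 2] ! (i - 1)) (\<alpha> i)) \<in> roots D"
proof -
  note [simp] = diagramD [OF \<alpha>] path_cartan_def pairing_add_left
  have "\<alpha> 3 + \<alpha> 4 \<in> roots D" by (rule add_root) auto
  then have "\<alpha> 3 + \<alpha> 4 + \<alpha> 2 \<in> roots D" by (intro add_root) auto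
  then have "\<alpha> 3 + \<alpha> 4 + \<alpha> 2 + \<alpha> 3 \<in> roots D" by (intro add_root) auto
  then have "\<alpha> 3 + \<alpha> 4 + \<alpha> 2 + \<alpha> 3 + \<alpha> 1 \<in> roots D" by (intro add_root) auto
  then have "\<alpha> 3 + \<alpha> 4 + \<alpha> 2 + \<alpha> 3 + \<alpha> 1 + \<alpha> 2 \<in> roots D" by (intro add_root) auto
  then have "\<alpha> 3 + \<alpha> 4 + \<alpha> 2 + \<alpha> 3 + \<alpha> 1 + \<alpha> 2 + \<alpha> 3 \<in> roots D" by (intro add_root) auto
  then have "\<alpha> 3 + \<alpha> 4 + \<alpha> 2 + \<alpha> 3 + \<alpha> 1 + \<alpha> 2 + \<alpha> 3 + \<alpha> 4 \<in> roots D" by (intro add_root) auto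
  then show ?thesis
    by (simp add: atLeastAtMost_1_numeral zscale_two zscale_three ac_simps)
qed

lemma type_G2_root:
  assumes \<alpha>: "diagram Type_G2 \<alpha>"
  shows "(\<Sum>i=1..2. \<alpha> i) \<in> roots D" "(\<Sum>i=1..2. zscale ([2, 1] ! (i - 1)) (\<alpha> i)) \<in> roots D"
proof -
  note [simp] = diagramD [OF \<alpha>] path_cartan_def pairing_add_left
  have "\<alpha> 1 + \<alpha> 2 \<in> roots D" by (rule add_root) auto
  moreover from this have "\<alpha> 1 + \<alpha> 2 + \<alpha> 1 \<in> roots D" by (intro add_root) auto
  ultimately show "(\<Sum>i=1..2. \<alpha> i) \<in> roots D" "(\<Sum>i=1..2. zscale ([2, 1] ! (i - 1)) (\<alpha> i)) \<in> roots D"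
    by (simp_all add: atLeastAtMost_1_numeral zscale_two ac_simps)
qed

text \<open>The remaining rows consist of roots, by the explicit chains of reflections above. For \<open>D\<^sub>n\<close> and \<open>B\<^sub>3\<close> only
the two simple roots in \<open>S\<^sup>p\<close> that will serve as \<open>\<delta>\<^sub>1\<close>, \<open>\<delta>\<^sub>2\<close> are recorded.\<close>

lemma table_root_cases:
  assumes "table_root D Sp \<sigma>" "\<sigma> \<notin> roots D"
  obtains (D2) \<alpha> where "diagram (Type_D 2) \<alpha>" "\<sigma> = \<alpha> 1 + \<alpha> 2"
  | (Dn) n \<alpha> where "3 \<le> n" "diagram (Type_D n) \<alpha>"
      "\<sigma> = (\<Sum>i=1..n. zscale (if n - 1 \<le> i then 1 else 2) (\<alpha> i))" "\<alpha> (n - 1) \<in> Sp" "\<alpha> n \<in> Sp"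
  | (B3) \<alpha> where "diagram (Type_B 3) \<alpha>" "\<sigma> = \<alpha> 1 + \<alpha> 2 + \<alpha> 2 + \<alpha> 3 + \<alpha> 3 + \<alpha> 3" "\<alpha> 1 \<in> Sp" "\<alpha> 2 \<in> Sp"
proof -
  obtain X c P \<alpha> where row: "spherical_table X c P" and \<alpha>: "diagram X \<alpha>"
    and \<sigma>: "\<sigma> = (\<Sum>i=1..dynkin_rank X. zscale (c i) (\<alpha> i))"
    and P: "\<alpha> ` {1..dynkin_rank X} \<inter> Sp = \<alpha> ` P"
    using assms(1) unfolding table_root_def diagram_def by blast
  from row show ?thesis
  proof cases
    case A1
    then show ?thesis using \<alpha> \<sigma> type_A_or_B_root [of 1 \<alpha>] assms(2) by simp
  next
    case (An n)
    then show ?thesis using \<alpha> \<sigma> type_A_or_B_root [of n \<alpha>] assms(2) by simp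
  next
    case (Bn n)
    then show ?thesis using \<alpha> \<sigma> type_A_or_B_root [of n \<alpha>] assms(2) by simp
  next
    case (Bn' n)
    then show ?thesis using \<alpha> \<sigma> type_A_or_B_root [of n \<alpha>] assms(2) by simp
  next
    case (Cn n)
    then show ?thesis using \<alpha> \<sigma> type_C_root [of n \<alpha>] assms(2) by simp
  next
    case (Cn' n)
    then show ?thesis using \<alpha> \<sigma> type_C_root [of n \<alpha>] assms(2) by simp
  next
    case F4
    then show ?thesis using \<alpha> \<sigma> type_F4_root [of \<alpha>] assms(2) by simp
  next
    case G2
    then show ?thesis using \<alpha> \<sigma> type_G2_root(2) [of \<alpha>] assms(2) by simp
  next
    case G2'
    then show ?thesis using \<alpha> \<sigma> type_G2_root(1) [of \<alpha>] assms(2) by simp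
  next
    case D2
    then show ?thesis using \<alpha> \<sigma> that(1) [of \<alpha>] by (simp add: atLeastAtMost_1_numeral)
  next
    case (Dn n)
    have "\<alpha> ` P \<subseteq> Sp" using P by blast
    moreover have "n - 1 \<in> P" "n \<in> P" using Dn by auto
    ultimately have "\<alpha> (n - 1) \<in> Sp" "\<alpha> n \<in> Sp" by auto
    then show ?thesis using \<alpha> \<sigma> Dn by (intro that(2) [of n \<alpha>]) simp_all
  next
    case B3
    then have "\<alpha> 1 \<in> Sp" "\<alpha> 2 \<in> Sp" using P by auto
    with B3 show ?thesis using \<alpha> \<sigma> that(3) [of \<alpha>]
      by (simp add: atLeastAtMost_1_numeral zscale_two zscale_three ac_simps)
  qed
qed


section \<open>The associated pair of roots\<close>

lemma coeff_outside_span: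
  assumes "x \<in> Z.span I" "I \<subseteq> simples D" "\<alpha> \<notin> I"
  shows "coeff x \<alpha> = 0"
proof -
  have "x \<in> Z.span (simples D) \<and> coeff x \<alpha> = 0"
    using assms(1)
  proof (induction rule: Z.span_induct_alt)
    case base
    show ?case by (simp add: Z.representation_zero Z.span_zero)
  next
    case (step c \<beta> y)
    then have "\<beta> \<in> simples D" "\<alpha> \<noteq> \<beta>" using assms(2,3) by auto
    then show ?case
      using step by (simp add: coeff_linear coeff_simple simple_in_span Z.span_scale Z.span_add)
  qed
  then show ?thesis ..
qed

text \<open>No cancellation is possible between the nonnegative coefficients of the two roots.\<close>

lemma positive_summand_in_span:
  assumes \<gamma>: "\<gamma>1 \<in> positive_roots D" "\<gamma>2 \<in> positive_roots D"
    and sum: "\<gamma>1 + \<gamma>2 \<in> Z.span I" and I: "I \<subseteq> simples D"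
  shows "\<gamma>1 \<in> Z.span I"
proof (rule coeff_eq_0_imp_span [OF _ I])
  note span = \<gamma> [THEN positive_rootD(1), THEN root_in_span_simples]
  show "\<gamma>1 \<in> Z.span (simples D)" by (rule span)
  fix \<alpha> assume "\<alpha> \<in> simples D - I"
  then have "coeff (\<gamma>1 + \<gamma>2) \<alpha> = 0" using coeff_outside_span [OF sum I] by blast
  then show "coeff \<gamma>1 \<alpha> = 0"
    using positive_rootD(2) [OF \<gamma>(1), of \<alpha>] positive_rootD(2) [OF \<gamma>(2), of \<alpha>]
    by (simp add: coeff_linear span)
qed

text \<open>The coefficient 1 rules out \<open>\<gamma>1 = \<plusminus>\<gamma>2\<close>, so that the condition on the rational span implies orthogonality.\<close>

lemma associated_pairE:
  assumes "associated_pair D \<sigma> P" and "coeff \<sigma> \<alpha> = 1"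
  obtains \<gamma>1 \<gamma>2 \<delta>1 \<delta>2 where "P = {\<gamma>1, \<gamma>2}" "\<gamma>1 \<in> positive_roots D" "\<gamma>2 \<in> positive_roots D"
    "\<sigma> = \<gamma>1 + \<gamma>2" "form \<gamma>1 \<gamma>2 = 0" "\<delta>1 \<in> simples D" "\<delta>2 \<in> simples D"
    "coroot D \<gamma>1 - coroot D \<gamma>2 = coroot D \<delta>1 - coroot D \<delta>2"
proof -
  obtain \<gamma>1 \<gamma>2 \<delta>1 \<delta>2 where *: "P = {\<gamma>1, \<gamma>2}" "\<gamma>1 \<in> positive_roots D" "\<gamma>2 \<in> positive_roots D"
    "\<sigma> = \<gamma>1 + \<gamma>2" "rat_span2 \<gamma>1 \<gamma>2 \<inter> roots D = {\<gamma>1, - \<gamma>1, \<gamma>2, - \<gamma>2}"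
    "\<delta>1 \<in> simples D" "\<delta>2 \<in> simples D" "coroot D \<gamma>1 - coroot D \<gamma>2 = coroot D \<delta>1 - coroot D \<delta>2"
    using assms(1) unfolding associated_pair_def by blast
  note \<gamma> = *(2,3) [THEN positive_rootD(1)]
  have "coeff \<gamma>1 \<alpha> + coeff \<gamma>2 \<alpha> = 1"
    using assms(2) *(4) \<gamma> [THEN root_in_span_simples] by (simp add: coeff_linear)
  moreover have "\<gamma>1 \<noteq> \<gamma>2"
  proof
    assume "\<gamma>1 = \<gamma>2"
    with calculation have "2 * coeff \<gamma>2 \<alpha> = 1" by simp
    then show False by presburger
  qed
  moreover have "\<gamma>1 \<noteq> - \<gamma>2"
    using calculation(1) \<gamma> [THEN root_in_span_simples] by (auto simp: coeff_linear)
  ultimately have "form \<gamma>1 \<gamma>2 = 0" using rat_span2_imp_orthogonal \<gamma> *(5) by blast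
  then show thesis using that * by blast
qed

text \<open>All that is needed about the unique associated pair of \<open>\<sigma>\<close>. The final disjunction records how the two
simple roots make \<open>\<gamma>1\<^sup>\<or> - \<gamma>2\<^sup>\<or>\<close> vanish on \<open>\<Xi>\<close>: through membership in \<open>S\<^sup>p\<close>, or through the condition on
elements of type \<open>D\<^sub>2\<close>.\<close>

definition special_pair :: "'l set \<Rightarrow> 'l \<Rightarrow> 'l \<Rightarrow> 'l \<Rightarrow> bool" where
  "special_pair Sp \<sigma> \<gamma>1 \<gamma>2 \<longleftrightarrow>
    \<gamma>1 \<in> roots D \<and> \<gamma>2 \<in> roots D \<and> \<sigma> = \<gamma>1 + \<gamma>2 \<and> form \<gamma>1 \<gamma>2 = 0 \<and>
    (\<forall>P. associated_pair D \<sigma> P \<longleftrightarrow> P = {\<gamma>1, \<gamma>2}) \<and>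
    (\<exists>\<delta>1 \<delta>2. coroot D \<gamma>1 - coroot D \<gamma>2 = coroot D \<delta>1 - coroot D \<delta>2 \<and>
      (\<delta>1 \<in> Sp \<and> \<delta>2 \<in> Sp \<or>
       \<delta>1 \<in> simples D \<and> \<delta>2 \<in> simples D \<and> \<langle>\<delta>1 | \<delta>2\<rangle> = 0 \<and> \<sigma> = \<delta>1 + \<delta>2))"

lemma special_pairI:
  assumes "\<gamma>1 \<in> roots D" "\<gamma>2 \<in> roots D" and sum: "\<sigma> = \<gamma>1 + \<gamma>2" and "form \<gamma>1 \<gamma>2 = 0"
    and pair: "associated_pair D (\<gamma>1 + \<gamma>2) {\<gamma>1, \<gamma>2}"
    and unique: "\<And>P. associated_pair D \<sigma> P \<Longrightarrow> P = {\<gamma>1, \<gamma>2}"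
    and diff: "coroot D \<gamma>1 - coroot D \<gamma>2 = coroot D \<delta>1 - coroot D \<delta>2"
    and \<delta>: "\<delta>1 \<in> Sp \<and> \<delta>2 \<in> Sp \<or>
      \<delta>1 \<in> simples D \<and> \<delta>2 \<in> simples D \<and> \<langle>\<delta>1 | \<delta>2\<rangle> = 0 \<and> \<sigma> = \<delta>1 + \<delta>2"
  shows "special_pair Sp \<sigma> \<gamma>1 \<gamma>2"
proof -
  have "associated_pair D \<sigma> P \<longleftrightarrow> P = {\<gamma>1, \<gamma>2}" for P
    using unique [of P] pair unfolding sum by blast
  then show ?thesis
    unfolding special_pair_def using assms(1-4) diff \<delta> by blast
qed

text \<open>Uniqueness comes from positivity: \<open>a + b\<close> has no other decomposition into two nonzero nonnegative
combinations of simple roots. The lengths of \<open>a\<close> and \<open>b\<close> may be unrelated, so norms would not help.\<close>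

lemma type_D2_special_pair:
  assumes simple: "a \<in> simples D" "b \<in> simples D" and ne: "a \<noteq> b"
    and pairing_0: "\<langle>a | b\<rangle> = 0"
    and \<sigma>: "\<sigma> = a + b" and nonroot: "\<sigma> \<notin> roots D"
  shows "special_pair Sp \<sigma> a b"
proof -
  note span = simple [THEN simple_in_span]
  have orth: "form a b = 0"
    using form_root [OF simple_root [OF simple(2)], of "a"] pairing_0 by simp
  have coeff_\<sigma>: "coeff \<sigma> \<beta> = of_bool (\<beta> = a \<or> \<beta> = b)" for \<beta>
    using ne by (auto simp: \<sigma> coeff_linear span coeff_simple simple)
  have "associated_pair D (a + b) {a, b}"
    by (rule associated_pairI [where ?\<alpha>1.0 = a and ?\<alpha>2.0 = b and ?\<delta>1.0 = a and ?\<delta>2.0 = b])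
      (use simple simple_root nonneg_comb_simple orth nonroot \<sigma> ne in \<open>simp_all add: coeff_simple\<close>)
  moreover have "P = {a, b}" if P: "associated_pair D \<sigma> P" for P
  proof -
    obtain \<gamma>1 \<gamma>2 where P_eq: "P = {\<gamma>1, \<gamma>2}" and \<gamma>: "\<gamma>1 \<in> positive_roots D" "\<gamma>2 \<in> positive_roots D"
      and sum: "\<sigma> = \<gamma>1 + \<gamma>2"
      using P coeff_\<sigma> [of "a"] by (auto elim!: associated_pairE)
    note \<gamma>_root = \<gamma> [THEN positive_rootD(1)]
    note \<gamma>_span = \<gamma>_root [THEN root_in_span_simples]
    have coeff_sum: "coeff \<gamma>1 \<beta> + coeff \<gamma>2 \<beta> = of_bool (\<beta> = a \<or> \<beta> = b)"
      "0 \<le> coeff \<gamma>1 \<beta>" "0 \<le> coeff \<gamma>2 \<beta>" for \<beta>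
      using coeff_\<sigma> [of \<beta>] \<gamma> [THEN positive_rootD(2)] by (simp_all add: sum coeff_linear \<gamma>_span)
    have other: "coeff \<gamma>1 \<beta> = 0" if "\<beta> \<noteq> a" "\<beta> \<noteq> b" for \<beta>
      using coeff_sum [of \<beta>] that by simp
    have "coeff \<gamma>1 a = 0 \<or> coeff \<gamma>1 a = 1" "coeff \<gamma>1 b = 0 \<or> coeff \<gamma>1 b = 1"
      using coeff_sum [of "a"] coeff_sum [of "b"] by auto
    then consider "\<And>\<beta>. coeff \<gamma>1 \<beta> = coeff 0 \<beta>" | "\<And>\<beta>. coeff \<gamma>1 \<beta> = coeff \<sigma> \<beta>"
      | "\<And>\<beta>. coeff \<gamma>1 \<beta> = coeff a \<beta>" | "\<And>\<beta>. coeff \<gamma>1 \<beta> = coeff b \<beta>"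
      using other ne unfolding coeff_\<sigma> coeff_simple [OF simple(1)] coeff_simple [OF simple(2)]
        Z.representation_zero by (smt (verit, best) of_bool_eq)
    then have "\<gamma>1 = 0 \<or> \<gamma>1 = \<sigma> \<or> \<gamma>1 = a \<or> \<gamma>1 = b"
      using span_eqI [OF \<gamma>_span(1), of 0] span_eqI [OF \<gamma>_span(1), of \<sigma>]
        span_eqI [OF \<gamma>_span(1), of "a"] span_eqI [OF \<gamma>_span(1), of "b"]
        span Z.span_zero [of "simples D"] Z.span_add [OF span] \<sigma> by cases auto
    then show ?thesis
      using root_nonzero [OF \<gamma>_root(1)] root_nonzero [OF \<gamma>_root(2)] sum \<sigma> P_eq by auto
  qed
  ultimately show ?thesis
    using special_pairI [OF simple_root [OF simple(1)] simple_root [OF simple(2)] \<sigma> orth _ _ refl]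
      simple pairing_0 \<sigma> by blast
qed

text \<open>In the usual coordinates \<open>\<sigma> = 2e\<^sub>1\<close> and the pair is \<open>e\<^sub>1 - e\<^sub>n, e\<^sub>1 + e\<^sub>n\<close>. Among the decompositions
\<open>(e\<^sub>1 - e\<^sub>i) + (e\<^sub>1 + e\<^sub>i)\<close> it is singled out by the condition on coroots: all norms are equal, so any
associated pair has \<open>\<gamma>\<^sub>1 - \<gamma>\<^sub>2 = \<delta>\<^sub>1 - \<delta>\<^sub>2\<close>, and \<open>\<alpha>\<^sub>n\<^sub>-\<^sub>1\<close>, \<open>\<alpha>\<^sub>n\<close> have odd coefficient in \<open>\<sigma>\<close>.\<close>

lemma type_Dn_special_pair:
  assumes n: "3 \<le> n" and \<alpha>: "diagram (Type_D n) \<alpha>"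
    and \<sigma>: "\<sigma> = (\<Sum>i=1..n. zscale (if n - 1 \<le> i then 1 else 2) (\<alpha> i))"
    and Sp: "\<alpha> (n - 1) \<in> Sp" "\<alpha> n \<in> Sp" and nonroot: "\<sigma> \<notin> roots D"
  shows "\<exists>\<gamma>1 \<gamma>2. special_pair Sp \<sigma> \<gamma>1 \<gamma>2"
proof -
  obtain m where m: "n = Suc (Suc m)" "1 \<le> m"
    using n by (intro that [of "n - 2"]) auto
  define p a b where "p = (\<Sum>i=1..m. \<alpha> i)" and "a = \<alpha> (Suc m)" and "b = \<alpha> (Suc (Suc m))"
  \<comment> \<open>The other path through the fork of the diagram, ending in \<open>\<alpha>\<^sub>n\<close> instead of \<open>\<alpha>\<^sub>n\<^sub>-\<^sub>1\<close>.\<close>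
  define \<beta> where "\<beta> = \<alpha>(Suc m := b)"
  let ?I = "\<alpha> ` {1..n}"
  let ?N = "form b b"
  note cartan = diagramD(3) [OF \<alpha>] path_cartan_def doubleton_eq_iff
  have simple: "\<alpha> i \<in> simples D" and root: "\<alpha> i \<in> roots D" if "1 \<le> i" "i \<le> n" for i
    using diagramD(1,2) [OF \<alpha>] that by auto
  have ab: "a \<in> simples D" "b \<in> simples D" "a \<in> roots D" "b \<in> roots D"
    using simple root m by (auto simp: a_def b_def)
  have ne: "a \<noteq> b" using diagramD(4) [OF \<alpha>, of "Suc m" n] m by (simp add: a_def b_def)
  have I: "?I \<subseteq> simples D" "?I \<subseteq> roots D" using simple root by auto

  have "(\<Sum>i=1..Suc m. \<alpha> i) \<in> roots D \<and>
      form (\<Sum>i=1..Suc m. \<alpha> i) (\<Sum>i=1..Suc m. \<alpha> i) = form (\<alpha> (Suc m)) (\<alpha> (Suc m))"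
    by (rule path_sum_root) (use m in \<open>auto simp: root cartan\<close>)
  moreover have "(\<Sum>i=1..Suc m. \<alpha> i) = p + a" by (simp add: p_def a_def)
  ultimately have \<gamma>1: "p + a \<in> roots D" "form (p + a) (p + a) = form a a" by (simp_all add: a_def)
  have "(\<Sum>i=1..Suc m. \<beta> i) \<in> roots D \<and>
      form (\<Sum>i=1..Suc m. \<beta> i) (\<Sum>i=1..Suc m. \<beta> i) = form (\<beta> (Suc m)) (\<beta> (Suc m))"
    by (rule path_sum_root) (use m in \<open>auto simp: \<beta>_def b_def root cartan\<close>)
  moreover have "(\<Sum>i=1..Suc m. \<beta> i) = p + b" by (simp add: p_def \<beta>_def)
  ultimately have \<gamma>2: "p + b \<in> roots D" "form (p + b) (p + b) = ?N" by (simp_all add: \<beta>_def)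
  have norm_a: "form a a = ?N"
    using pairing_root_commute [of a "\<alpha> m"] pairing_root_commute [of b "\<alpha> m"] m root [of m] ab
    by (simp add: a_def b_def cartan)
  have norm: "form (\<alpha> i) (\<alpha> i) = ?N" if "1 \<le> i" "i \<le> n" for i
  proof (cases "i = n")
    case False
    then have "i \<le> Suc m" using that m by simp
    then show ?thesis using that(1)
    proof (induction rule: inc_induct)
      case base
      show ?case using norm_a by (simp add: a_def)
    next
      case (step k)
      then show ?case
        using pairing_root_commute [of "\<alpha> k" "\<alpha> (Suc k)"] m root [of k] root [of "Suc k"]
        by (simp add: cartan)
    qed
  qed (simp add: m b_def)

  have "\<sigma> = (\<Sum>i=1..m. zscale (if n - 1 \<le> i then 1 else 2) (\<alpha> i)) + a + b"
    by (simp add: \<sigma> m a_def b_def)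
  also have "(\<Sum>i=1..m. zscale (if n - 1 \<le> i then 1 else 2) (\<alpha> i)) = (\<Sum>i=1..m. zscale 2 (\<alpha> i))"
    by (rule sum.cong) (auto simp: m)
  also have "\<dots> = p + p" by (simp add: p_def zscale_two sum.distrib)
  finally have \<sigma>_eq: "\<sigma> = (p + a) + (p + b)" by (simp add: ac_simps)
  have \<sigma>_span: "\<sigma> \<in> Z.span ?I"
    unfolding \<sigma> by (intro Z.span_sum Z.span_scale Z.span_base) auto

  have "inj_on \<alpha> {1..n}" using \<alpha> by (simp add: diagram_def)
  then have coeff_p: "coeff p a = 0" "coeff p b = 0"
    using coeff_sum_enumeration [of \<alpha> "{1..n}" "{1..m}" "Suc m"]
      coeff_sum_enumeration [of \<alpha> "{1..n}" "{1..m}" n] I(1) by (auto simp: m p_def a_def b_def)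
  have p: "p \<in> Z.span (simples D)" "nonneg_comb (simples D) p"
    using m simple simple_in_span nonneg_comb_simple unfolding p_def
    by (auto intro!: Z.span_sum nonneg_comb_sum)
  have span: "a \<in> Z.span (simples D)" "b \<in> Z.span (simples D)" using ab simple_in_span by auto
  note coeff_simps = coeff_linear p span Z.span_add coeff_p coeff_simple ab(1,2) ne ne [symmetric]
  have coeff_\<sigma>: "coeff \<sigma> a = 1" "coeff \<sigma> b = 1" by (simp_all add: \<sigma>_eq coeff_simps)

  have pairing_p: "\<langle>p | \<alpha> (Suc m)\<rangle> = - 1" "\<langle>p | \<alpha> (Suc (Suc m))\<rangle> = - 1"
  proof -
    have "\<langle>p | \<alpha> j\<rangle> = (\<Sum>i=1..m. if i = m then - 1 else 0)" if "j = Suc m \<or> j = Suc (Suc m)" for j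
      unfolding p_def pairing_sum_left by (rule sum.cong) (use that m in \<open>auto simp: cartan\<close>)
    then show "\<langle>p | \<alpha> (Suc m)\<rangle> = - 1" "\<langle>p | \<alpha> (Suc (Suc m))\<rangle> = - 1" using m by auto
  qed
  have "2 * form (p + a) (p + b) =
      2 * form (p + a) (p + a) - 2 * form (p + a) a + 2 * form (p + a) b"
    by (simp add: form_linear)
  also have "\<dots> = 0"
    unfolding form_root [OF ab(3)] form_root [OF ab(4)] \<gamma>1(2) norm_a
    using m pairing_p by (simp add: pairing_linear a_def b_def cartan)
  finally have orth: "form (p + a) (p + b) = 0" by simp
  have form_\<sigma>: "form \<sigma> \<sigma> = 2 * ?N"
    using \<gamma>1(2) \<gamma>2(2) norm_a orth form_commute [of "p + a" "p + b"]
    unfolding \<sigma>_eq form_add_left [of "p + a" "p + b"] form_right(1) [of _ "p + a" "p + b"] by simp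

  have coroots: "coroot D (p + a) - coroot D (p + b) = coroot D a - coroot D b"
    by (rule coroot_difference_eqI [where r = 1]) (use \<gamma>1 \<gamma>2 norm_a ab in simp_all)
  have nonneg: "nonneg_comb (simples D) (p + a)" "nonneg_comb (simples D) (p + b)"
    by (simp_all add: nonneg_comb_add nonneg_comb_simple ab p)
  have "associated_pair D (p + a + (p + b)) {p + a, p + b}"
    by (rule associated_pairI [where ?\<alpha>1.0 = a and ?\<alpha>2.0 = b, OF \<gamma>1(1) \<gamma>2(1) nonneg orth _ _ _ _ ab(1,2) coroots])
      (use \<sigma>_eq nonroot in \<open>simp_all add: coeff_simps\<close>)
  moreover have "P = {p + a, p + b}" if P: "associated_pair D \<sigma> P" for P
  proof -
    obtain \<gamma>1 \<gamma>2 \<delta>1 \<delta>2 where P_eq: "P = {\<gamma>1, \<gamma>2}"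
      and \<gamma>: "\<gamma>1 \<in> positive_roots D" "\<gamma>2 \<in> positive_roots D" and sum: "\<sigma> = \<gamma>1 + \<gamma>2"
      and orth': "form \<gamma>1 \<gamma>2 = 0" and \<delta>: "\<delta>1 \<in> simples D" "\<delta>2 \<in> simples D"
      and eq: "coroot D \<gamma>1 - coroot D \<gamma>2 = coroot D \<delta>1 - coroot D \<delta>2"
      using associated_pairE [OF P coeff_\<sigma>(1)] by metis
    note \<gamma>_root = \<gamma> [THEN positive_rootD(1)]
    have "\<gamma>1 \<in> Z.span ?I" "\<gamma>2 \<in> Z.span ?I"
      using positive_summand_in_span [OF \<gamma> _ I(1)] positive_summand_in_span [OF \<gamma>(2,1) _ I(1)]
        \<sigma>_span sum by (simp_all add: add.commute)
    moreover have norm_dvd: "?N dvd form \<delta> \<delta>" if "\<delta> \<in> ?I" for \<delta>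
      using that norm by auto
    ultimately have "?N dvd form \<gamma>1 \<gamma>1" "?N dvd form \<gamma>2 \<gamma>2"
      using dvd_form_self [OF _ I(2) norm_dvd] by blast+
    then obtain k1 k2 where k: "form \<gamma>1 \<gamma>1 = ?N * k1" "form \<gamma>2 \<gamma>2 = ?N * k2" by (auto elim!: dvdE)
    have N: "0 < ?N" using form_root_pos ab by blast
    have k_pos: "0 < k1" "0 < k2"
      using \<gamma>_root [THEN form_root_pos] N by (simp_all add: k zero_less_mult_iff)
    have "?N * (k1 + k2) = ?N * 2"
      using form_\<sigma> orth' form_commute [of \<gamma>1 \<gamma>2] by (simp add: sum form_linear k algebra_simps)
    then have "k1 = 1" "k2 = 1" using N k_pos by auto
    then have norms: "form \<gamma>1 \<gamma>1 = ?N" "form \<gamma>2 \<gamma>2 = ?N" using k by simp_all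
    have "\<gamma>1 - zscale 1 \<gamma>2 = a - b \<or> \<gamma>1 - zscale 1 \<gamma>2 = b - a"
      by (rule coroot_difference_eqD [OF \<gamma>_root ab(1,2) ne \<delta> _ _ _ _ _ eq])
        (use norms norm_a coeff_\<sigma> sum in simp_all)
    moreover have "zscale 2 \<gamma>1 = (\<gamma>1 - zscale 1 \<gamma>2) + \<sigma>" by (simp add: sum zscale_two)
    moreover have "zscale 2 (p + a) = (a - b) + \<sigma>" "zscale 2 (p + b) = (b - a) + \<sigma>"
      by (simp_all add: \<sigma>_eq zscale_two algebra_simps)
    ultimately have "zscale 2 \<gamma>1 = zscale 2 (p + a) \<or> zscale 2 \<gamma>1 = zscale 2 (p + b)"
      by metis
    then have "\<gamma>1 = p + a \<or> \<gamma>1 = p + b" unfolding zscale_cancel by simp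
    then show ?thesis using sum \<sigma>_eq P_eq by auto
  qed
  moreover have "a \<in> Sp" "b \<in> Sp" using Sp m by (simp_all add: a_def b_def)
  ultimately have "special_pair Sp \<sigma> (p + a) (p + b)"
    using special_pairI [OF \<gamma>1(1) \<gamma>2(1) \<sigma>_eq orth _ _ coroots] by blast
  then show ?thesis by blast
qed

text \<open>In the usual coordinates \<open>\<sigma> = e\<^sub>1 + e\<^sub>2 + e\<^sub>3\<close> and the pair consists of the long root \<open>e\<^sub>1 + e\<^sub>3\<close> and the short
root \<open>e\<^sub>2\<close>. Any associated pair has one root of each length, since the norms add up to three times
the norm of a short root. For a long root \<open>x\<close> and a short root \<open>y\<close> the condition on coroots reads
\<open>x - 2y = \<plusminus>(\<alpha>\<^sub>1 - \<alpha>\<^sub>2)\<close>, and the coefficient of \<open>\<alpha>\<^sub>1\<close> in \<open>\<sigma>\<close> fixes the sign.\<close>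

lemma type_B3_special_pair:
  assumes \<alpha>: "diagram (Type_B 3) \<alpha>" and \<sigma>: "\<sigma> = \<alpha> 1 + \<alpha> 2 + \<alpha> 2 + \<alpha> 3 + \<alpha> 3 + \<alpha> 3"
    and Sp: "\<alpha> 1 \<in> Sp" "\<alpha> 2 \<in> Sp" and nonroot: "\<sigma> \<notin> roots D"
  shows "\<exists>\<gamma>1 \<gamma>2. special_pair Sp \<sigma> \<gamma>1 \<gamma>2"
proof -
  define a b c where "a = \<alpha> 1" and "b = \<alpha> 2" and "c = \<alpha> 3"
  note abc_def = a_def b_def c_def
  have simple: "a \<in> simples D" "b \<in> simples D" "c \<in> simples D"
    and root: "a \<in> roots D" "b \<in> roots D" "c \<in> roots D"
    using diagramD(1,2) [OF \<alpha>] by (simp_all add: abc_def)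
  have ne: "a \<noteq> b" "b \<noteq> c" "a \<noteq> c"
    using diagramD(4) [OF \<alpha>, of 1 2] diagramD(4) [OF \<alpha>, of 2 3] diagramD(4) [OF \<alpha>, of 1 3]
    by (simp_all add: abc_def)
  have cartan: "\<langle>a | b\<rangle> = - 1" "\<langle>b | a\<rangle> = - 1" "\<langle>b | c\<rangle> = - 2" "\<langle>c | b\<rangle> = - 1" "\<langle>a | c\<rangle> = 0"
    "\<langle>c | a\<rangle> = 0" "\<langle>a | a\<rangle> = 2" "\<langle>b | b\<rangle> = 2" "\<langle>c | c\<rangle> = 2"
    by (simp_all add: abc_def diagramD(3) [OF \<alpha>] path_cartan_def)
  note span = simple [THEN simple_in_span]
  note coeff_simps = coeff_linear span Z.span_add coeff_simple simple ne ne [symmetric]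
  let ?N = "form c c"
  have N: "0 < ?N" by (rule form_root_pos [OF root(3)])
  have norm_b: "form b b = 2 * ?N" using pairing_root_commute [OF root(2,3)] cartan by simp
  have norm_a: "form a a = 2 * ?N" using pairing_root_commute [OF root(1,2)] cartan norm_b by simp
  define \<gamma>1 \<gamma>2 where "\<gamma>1 = a + b + c + c" and "\<gamma>2 = b + c"
  have \<sigma>_eq: "\<sigma> = \<gamma>1 + \<gamma>2" by (simp add: \<sigma> \<gamma>1_def \<gamma>2_def abc_def ac_simps)
  have \<gamma>2: "\<gamma>2 \<in> roots D" "form \<gamma>2 \<gamma>2 = ?N"
    using add_root [OF root(2,3)] cartan by (simp_all add: \<gamma>2_def add.commute)
  have "a + b \<in> roots D" "form (a + b) (a + b) = form a a"
    using add_root [OF root(2,1)] cartan by simp_all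
  moreover have "reflection D c (a + b) = \<gamma>1"
    by (simp add: reflection_def pairing_linear cartan zscale_two \<gamma>1_def add.assoc)
  ultimately have \<gamma>1: "\<gamma>1 \<in> roots D" "form \<gamma>1 \<gamma>1 = 2 * ?N"
    using reflection_root [OF root(3), of "a + b"] form_reflection [OF root(3), of "a + b" "a + b"] norm_a
    by simp_all
  have "2 * form \<gamma>1 \<gamma>2 = 2 * form \<gamma>1 b + 2 * form \<gamma>1 c" by (simp add: \<gamma>2_def form_linear)
  also have "\<dots> = 0"
    unfolding form_root [OF root(2)] form_root [OF root(3)] norm_b
    by (simp add: \<gamma>1_def pairing_linear cartan)
  finally have orth: "form \<gamma>1 \<gamma>2 = 0" by simp
  have form_\<sigma>: "form \<sigma> \<sigma> = 3 * ?N"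
    using orth form_commute [of \<gamma>1 \<gamma>2] \<gamma>1 \<gamma>2 by (simp add: \<sigma>_eq form_linear)
  have coeff_\<sigma>: "coeff \<sigma> a = 1" "coeff \<sigma> b = 2"
    by (simp_all add: \<sigma>_eq \<gamma>1_def \<gamma>2_def coeff_simps)
  let ?I = "{a, b, c}"
  have I: "?I \<subseteq> simples D" "?I \<subseteq> roots D" using simple root by auto
  have \<sigma>_span: "\<sigma> \<in> Z.span ?I"
    unfolding \<sigma>_eq \<gamma>1_def \<gamma>2_def by (intro Z.span_add Z.span_base) auto
  have diff: "\<gamma>1 - zscale 2 \<gamma>2 = a - b" by (simp add: \<gamma>1_def \<gamma>2_def zscale_two algebra_simps)
  have coroots: "coroot D \<gamma>1 - coroot D \<gamma>2 = coroot D a - coroot D b"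
    by (rule coroot_difference_eqI [where r = 2]) (use \<gamma>1 \<gamma>2 norm_a norm_b root diff in simp_all)
  have nonneg: "nonneg_comb (simples D) \<gamma>1" "nonneg_comb (simples D) \<gamma>2"
    unfolding \<gamma>1_def \<gamma>2_def by (simp_all add: nonneg_comb_add nonneg_comb_simple simple)
  have "associated_pair D (\<gamma>1 + \<gamma>2) {\<gamma>1, \<gamma>2}"
    by (rule associated_pairI [where ?\<alpha>1.0 = a and ?\<alpha>2.0 = b, OF \<gamma>1(1) \<gamma>2(1) nonneg orth _ _ _ _ simple(1,2) coroots])
      (use \<sigma>_eq nonroot in \<open>simp_all add: \<gamma>1_def \<gamma>2_def coeff_simps\<close>)
  moreover have "P = {\<gamma>1, \<gamma>2}" if P: "associated_pair D \<sigma> P" for P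
  proof -
    obtain \<gamma>1' \<gamma>2' \<delta>1 \<delta>2 where P_eq: "P = {\<gamma>1', \<gamma>2'}"
      and \<gamma>': "\<gamma>1' \<in> positive_roots D" "\<gamma>2' \<in> positive_roots D" and sum: "\<sigma> = \<gamma>1' + \<gamma>2'"
      and orth': "form \<gamma>1' \<gamma>2' = 0" and \<delta>: "\<delta>1 \<in> simples D" "\<delta>2 \<in> simples D"
      and eq: "coroot D \<gamma>1' - coroot D \<gamma>2' = coroot D \<delta>1 - coroot D \<delta>2"
      using associated_pairE [OF P coeff_\<sigma>(1)] by metis
    note \<gamma>'_root = \<gamma>' [THEN positive_rootD(1)]
    have "\<gamma>1' \<in> Z.span ?I" "\<gamma>2' \<in> Z.span ?I"
      using positive_summand_in_span [OF \<gamma>' _ I(1)] positive_summand_in_span [OF \<gamma>'(2,1) _ I(1)]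
        \<sigma>_span sum by (simp_all add: add.commute)
    moreover have norm_dvd: "?N dvd form \<alpha> \<alpha>" if "\<alpha> \<in> ?I" for \<alpha>
      using that norm_a norm_b by auto
    ultimately have "?N dvd form \<gamma>1' \<gamma>1'" "?N dvd form \<gamma>2' \<gamma>2'"
      using dvd_form_self [OF _ I(2) norm_dvd] by blast+
    then obtain k1 k2 where k: "form \<gamma>1' \<gamma>1' = ?N * k1" "form \<gamma>2' \<gamma>2' = ?N * k2"
      by (auto elim!: dvdE)
    have k_pos: "0 < k1" "0 < k2"
      using \<gamma>'_root [THEN form_root_pos] N by (simp_all add: k zero_less_mult_iff)
    have "?N * (k1 + k2) = ?N * 3"
      using form_\<sigma> orth' form_commute [of \<gamma>1' \<gamma>2'] by (simp add: sum form_linear k algebra_simps)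
    then have "k1 + k2 = 3" using N by simp
    with k_pos have "k1 = 2 \<and> k2 = 1 \<or> k1 = 1 \<and> k2 = 2" by presburger
    moreover have long_short: "x = \<gamma>1"
      if x: "x \<in> roots D" "y \<in> roots D" "\<sigma> = x + y" "form x x = 2 * ?N" "form y y = ?N"
        and \<delta>: "\<delta>1 \<in> simples D" "\<delta>2 \<in> simples D"
        and eq: "coroot D x - coroot D y = coroot D \<delta>1 - coroot D \<delta>2" for x y \<delta>1 \<delta>2
    proof -
      have "x - zscale 2 y = a - b \<or> x - zscale 2 y = b - a"
        by (rule coroot_difference_eqD [OF x(1,2) simple(1,2) ne(1) \<delta> _ _ _ _ _ eq])
          (use x norm_a norm_b coeff_\<sigma> in simp_all)
      moreover have "x - zscale 2 y \<noteq> b - a"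
      proof
        assume "x - zscale 2 y = b - a"
        from arg_cong [OF this, of "\<lambda>z. coeff z a"] have "coeff x a - 2 * coeff y a = - 1"
          using x(1,2) [THEN root_in_span_simples] by (simp add: coeff_simps Z.span_scale)
        moreover have "coeff x a + coeff y a = 1"
          using coeff_\<sigma>(1) x(1,2) [THEN root_in_span_simples] by (simp add: x(3) coeff_linear)
        ultimately have "3 * coeff y a = 2" by linarith
        then show False by presburger
      qed
      ultimately have "x - zscale 2 y = \<gamma>1 - zscale 2 \<gamma>2" using diff by simp
      moreover have "zscale 3 x = (x - zscale 2 y) + zscale 2 (x + y)"
        by (simp add: zscale_two zscale_three algebra_simps)
      moreover have "zscale 3 \<gamma>1 = (\<gamma>1 - zscale 2 \<gamma>2) + zscale 2 (\<gamma>1 + \<gamma>2)"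
        by (simp add: zscale_two zscale_three algebra_simps)
      ultimately have "zscale 3 x = zscale 3 \<gamma>1" using x(3) \<sigma>_eq by simp
      then show ?thesis by (simp add: zscale_cancel)
    qed
    ultimately have "\<gamma>1' = \<gamma>1 \<or> \<gamma>2' = \<gamma>1"
    proof (elim disjE conjE)
      assume "k1 = 2" "k2 = 1"
      then show ?thesis using long_short [OF \<gamma>'_root sum _ _ \<delta> eq] k by simp
    next
      assume "k1 = 1" "k2 = 2"
      moreover have "coroot D \<gamma>2' - coroot D \<gamma>1' = coroot D \<delta>2 - coroot D \<delta>1"
        using eq by (metis minus_diff_eq)
      ultimately show ?thesis
        using long_short [OF \<gamma>'_root(2,1) _ _ _ \<delta>(2,1)] k sum by (simp add: add.commute)
    qed
    then show ?thesis using sum \<sigma>_eq P_eq by (auto simp: add.commute)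
  qed
  moreover have "a \<in> Sp" "b \<in> Sp" using Sp by (simp_all add: a_def b_def)
  ultimately have "special_pair Sp \<sigma> \<gamma>1 \<gamma>2"
    using special_pairI [OF \<gamma>1(1) \<gamma>2(1) \<sigma>_eq orth _ _ coroots] by blast
  then show ?thesis by blast
qed

lemma special_pair_exists:
  assumes "table_root D Sp \<sigma>" "\<sigma> \<notin> roots D"
  shows "\<exists>\<gamma>1 \<gamma>2. special_pair Sp \<sigma> \<gamma>1 \<gamma>2"
  using assms
proof (cases rule: table_root_cases)
  case (D2 \<alpha>)
  then show ?thesis
    using type_D2_special_pair [of "\<alpha> 1" "\<alpha> 2" \<sigma>] assms(2)
      diagramD(1) [OF D2(1)] diagramD(3,4) [OF D2(1), of 1 2] by auto
next
  case Dn
  then show ?thesis using type_Dn_special_pair assms(2) by blast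
next
  case B3
  then show ?thesis using type_B3_special_pair assms(2) by blast
qed


section \<open>The involution on the simple roots of the associated group\<close>

lemma hat_root: "\<sigma> \<in> roots D \<Longrightarrow> hat D \<sigma> = {coroot D \<sigma>}"
  by (simp add: hat_def)

lemma hat_special_pair:
  assumes "special_pair Sp \<sigma> \<gamma>1 \<gamma>2" "\<sigma> \<notin> roots D"
  shows "hat D \<sigma> = {coroot D \<gamma>1, coroot D \<gamma>2}"
proof -
  have "associated_pair D \<sigma> P \<longleftrightarrow> P = {\<gamma>1, \<gamma>2}" for P
    using assms(1) unfolding special_pair_def by blast
  then have "(THE P. associated_pair D \<sigma> P) = {\<gamma>1, \<gamma>2}" by (intro the_equality) blast+
  then show ?thesis using assms(2) by (simp add: hat_def)
qed

text \<open>The pair is labelled so that a given element of \<open>\<sigma>\<^sup>\<and>\<close> comes first; the statement is symmetric otherwise.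
The last conclusion is the central equation of the whole argument.\<close>

lemma nonroot_hatE:
  assumes datum: "weak_spherical_datum D \<Xi> \<Sigma> Sp" and \<sigma>: "\<sigma> \<in> \<Sigma>" "\<sigma> \<notin> roots D" and v: "v \<in> hat D \<sigma>"
  obtains \<gamma>1 \<gamma>2 where "v = coroot D \<gamma>1" "hat D \<sigma> = {coroot D \<gamma>1, coroot D \<gamma>2}"
    "\<gamma>1 \<in> roots D" "\<gamma>2 \<in> roots D" "\<sigma> = \<gamma>1 + \<gamma>2" "form \<gamma>1 \<gamma>2 = 0"
    "\<And>\<tau>. \<tau> \<in> \<Sigma> \<Longrightarrow> \<langle>\<tau> | \<gamma>1\<rangle> = \<langle>\<tau> | \<gamma>2\<rangle>"
proof -
  have "table_root D Sp \<sigma>" using datum \<sigma>(1) by (simp add: weak_spherical_datum_def)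
  then obtain \<gamma>1 \<gamma>2 where special: "special_pair Sp \<sigma> \<gamma>1 \<gamma>2"
    using special_pair_exists \<sigma>(2) by blast
  then obtain \<delta>1 \<delta>2 where \<gamma>: "\<gamma>1 \<in> roots D" "\<gamma>2 \<in> roots D" and sum: "\<sigma> = \<gamma>1 + \<gamma>2"
    and orth: "form \<gamma>1 \<gamma>2 = 0"
    and diff: "coroot D \<gamma>1 - coroot D \<gamma>2 = coroot D \<delta>1 - coroot D \<delta>2"
    and \<delta>: "\<delta>1 \<in> Sp \<and> \<delta>2 \<in> Sp \<or>
       \<delta>1 \<in> simples D \<and> \<delta>2 \<in> simples D \<and> \<langle>\<delta>1 | \<delta>2\<rangle> = 0 \<and> \<sigma> = \<delta>1 + \<delta>2"
    unfolding special_pair_def by blast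
  have hat: "hat D \<sigma> = {coroot D \<gamma>1, coroot D \<gamma>2}" using hat_special_pair special \<sigma>(2) by blast
  have vanish: "\<langle>\<tau> | \<gamma>1\<rangle> = \<langle>\<tau> | \<gamma>2\<rangle>" if "\<tau> \<in> \<Sigma>" for \<tau>
  proof -
    have \<tau>: "\<tau> \<in> \<Xi>" using datum that by (auto simp: weak_spherical_datum_def)
    have "pairing D \<tau> (coroot D \<delta>1 - coroot D \<delta>2) = 0"
      using \<delta>
    proof
      assume "\<delta>1 \<in> Sp \<and> \<delta>2 \<in> Sp"
      then show ?thesis using datum \<tau> by (auto simp: weak_spherical_datum_def pairing_linear)
    next
      assume "\<delta>1 \<in> simples D \<and> \<delta>2 \<in> simples D \<and> \<langle>\<delta>1 | \<delta>2\<rangle> = 0 \<and> \<sigma> = \<delta>1 + \<delta>2"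
      then show ?thesis using datum \<tau> \<sigma>(1) unfolding weak_spherical_datum_def by blast
    qed
    then show ?thesis by (simp add: diff [symmetric] pairing_linear)
  qed
  consider "v = coroot D \<gamma>1" | "v = coroot D \<gamma>2" using v hat by blast
  then show thesis
  proof cases
    case 1
    then show ?thesis using that [of \<gamma>1 \<gamma>2] hat \<gamma> sum orth vanish by blast
  next
    case 2
    show ?thesis
      by (rule that [OF 2 _ \<gamma>(2,1)])
        (use hat sum orth vanish in \<open>auto simp: add.commute form_commute\<close>)
  qed
qed

lemma hat_eq_doubleton:
  assumes "weak_spherical_datum D \<Xi> \<Sigma> Sp" "\<sigma> \<in> \<Sigma>"
  shows "\<exists>v w. hat D \<sigma> = {v, w}"
proof (cases "\<sigma> \<in> roots D")
  case True
  then show ?thesis by (auto simp: hat_root)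
next
  case False
  have "table_root D Sp \<sigma>" using assms by (simp add: weak_spherical_datum_def)
  then obtain \<gamma>1 \<gamma>2 where "special_pair Sp \<sigma> \<gamma>1 \<gamma>2" using special_pair_exists False by blast
  then show ?thesis using hat_special_pair False by blast
qed

text \<open>Let \<open>\<gamma>1\<close>, \<open>\<gamma>2\<close> be the pair of one of the two elements, and \<open>\<tau>\<close> the other one; the common coroot is that
of \<open>\<gamma>1\<close>. The nontrivial cases rest on \<open>\<langle>\<tau> | \<gamma>1\<rangle> = \<langle>\<tau> | \<gamma>2\<rangle>\<close>. If \<open>\<tau>\<close> is a root, then \<open>\<tau> = \<gamma>1\<close> and the
equation reads \<open>2 = 0\<close>. If \<open>\<tau> = \<gamma>1 + \<beta>2\<close>, it gives \<open>\<langle>\<beta>2 | \<gamma>2\<rangle> = 2\<close>. By symmetry \<open>\<langle>\<gamma>2 | \<beta>2\<rangle> = 2\<close>, and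
together they say that \<open>\<gamma>2 - \<beta>2\<close> has norm 0.\<close>

lemma hat_disjoint:
  assumes datum: "weak_spherical_datum D \<Xi> \<Sigma> Sp" and \<sigma>: "\<sigma> \<in> \<Sigma>" and \<tau>: "\<tau> \<in> \<Sigma>"
    and v: "v \<in> hat D \<sigma>" "v \<in> hat D \<tau>"
  shows "\<sigma> = \<tau>"
proof -
  have coroot_eqD: "\<beta> = \<gamma>" if "\<beta> \<in> roots D" "\<gamma> \<in> roots D" "coroot D \<beta> = coroot D \<gamma>" for \<beta> \<gamma>
    using that inj_coroot by (simp add: inj_on_eq_iff)
  have mixed: False
    if \<sigma>: "\<sigma> \<in> \<Sigma>" "\<sigma> \<in> roots D" and \<tau>: "\<tau> \<in> \<Sigma>" "\<tau> \<notin> roots D" and v: "v \<in> hat D \<sigma>" "v \<in> hat D \<tau>"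
    for \<sigma> \<tau>
  proof -
    obtain \<gamma>1 \<gamma>2 where \<gamma>: "v = coroot D \<gamma>1" "\<gamma>1 \<in> roots D" "\<gamma>2 \<in> roots D" "form \<gamma>1 \<gamma>2 = 0"
      and vanish: "\<And>\<tau>. \<tau> \<in> \<Sigma> \<Longrightarrow> \<langle>\<tau> | \<gamma>1\<rangle> = \<langle>\<tau> | \<gamma>2\<rangle>"
      using nonroot_hatE [OF datum \<tau> v(2)] by metis
    have "\<sigma> = \<gamma>1" using \<sigma> v(1) \<gamma> coroot_eqD by (simp add: hat_root)
    then show False
      using vanish [OF \<sigma>(1)] pairing_root_coroot [OF \<gamma>(2)] form_0_imp_pairing_0 [OF \<gamma>(3,4)] by simp
  qed
  consider "\<sigma> \<in> roots D" "\<tau> \<in> roots D" | "\<sigma> \<notin> roots D" "\<tau> \<notin> roots D"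
    using mixed \<sigma> \<tau> v by blast
  then show ?thesis
  proof cases
    case 1
    then show ?thesis using v coroot_eqD by (simp add: hat_root)
  next
    case 2
    obtain \<gamma>1 \<gamma>2 where \<gamma>: "v = coroot D \<gamma>1" "\<gamma>1 \<in> roots D" "\<gamma>2 \<in> roots D" "\<sigma> = \<gamma>1 + \<gamma>2" "form \<gamma>1 \<gamma>2 = 0"
      and \<gamma>_vanish: "\<And>\<tau>. \<tau> \<in> \<Sigma> \<Longrightarrow> \<langle>\<tau> | \<gamma>1\<rangle> = \<langle>\<tau> | \<gamma>2\<rangle>"
      using nonroot_hatE [OF datum \<sigma> 2(1) v(1)] by metis
    obtain \<beta>1 \<beta>2 where \<beta>: "v = coroot D \<beta>1" "\<beta>1 \<in> roots D" "\<beta>2 \<in> roots D" "\<tau> = \<beta>1 + \<beta>2" "form \<beta>1 \<beta>2 = 0"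
      and \<beta>_vanish: "\<And>\<tau>. \<tau> \<in> \<Sigma> \<Longrightarrow> \<langle>\<tau> | \<beta>1\<rangle> = \<langle>\<tau> | \<beta>2\<rangle>"
      using nonroot_hatE [OF datum \<tau> 2(2) v(2)] by metis
    have eq: "\<beta>1 = \<gamma>1" using coroot_eqD \<gamma>(1,2) \<beta>(1,2) by simp
    have "\<langle>\<gamma>1 | \<gamma>2\<rangle> = 0" "\<langle>\<gamma>2 | \<gamma>1\<rangle> = 0" "\<langle>\<gamma>1 | \<beta>2\<rangle> = 0" "\<langle>\<beta>2 | \<gamma>1\<rangle> = 0"
      using form_0_imp_pairing_0 \<gamma> \<beta> eq form_commute by metis+
    then have "\<langle>\<beta>2 | \<gamma>2\<rangle> = 2" "\<langle>\<gamma>2 | \<beta>2\<rangle> = 2"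
      using \<gamma>_vanish [OF \<tau>] \<beta>_vanish [OF \<sigma>] pairing_root_coroot [OF \<gamma>(2)]
      by (simp_all add: \<gamma>(4) \<beta>(4) eq pairing_linear)
    then have "form (\<gamma>2 - \<beta>2) (\<gamma>2 - \<beta>2) = 0"
      using pairing_root_commute [OF \<gamma>(3) \<beta>(3)] form_root [OF \<beta>(3), of \<gamma>2] form_commute [of \<gamma>2 \<beta>2]
      by (simp add: form_linear)
    then have "\<gamma>2 - \<beta>2 = 0"
      using \<gamma>(3) \<beta>(3) by (intro form_nondegenerate Z.span_diff root_in_span_simples)
    then show ?thesis using \<gamma>(4) \<beta>(4) eq by simp
  qed
qed

lemma associated_datum_simps:
  "pairing (associated_datum D \<Sigma>) y x = pairing D x y"
  "simples (associated_datum D \<Sigma>) = hat_set D \<Sigma>"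
  by (simp_all add: associated_datum_def subgroup_datum_def dual_datum_def)

lemma coroot_associated_datum:
  "\<gamma> \<in> roots D \<Longrightarrow> coroot (associated_datum D \<Sigma>) (coroot D \<gamma>) = \<gamma>"
  using inj_coroot by (simp add: associated_datum_def subgroup_datum_def dual_datum_def)

text \<open>An element \<open>v \<noteq> s v\<close> comes from a pair \<open>\<gamma>1\<close>, \<open>\<gamma>2\<close>, whose orthogonality is the first condition. For the
second one, \<open>v - s v\<close> is 0 or \<open>\<gamma>1\<^sup>\<or> - \<gamma>2\<^sup>\<or>\<close>, which is orthogonal to \<open>\<Sigma>\<close>, and the coroots of \<open>w\<close> and
\<open>s w\<close> add up to \<open>\<tau>\<close> or to \<open>2\<tau>\<close> with \<open>\<tau>\<close> in \<open>\<Sigma>\<close>.\<close>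

lemma folding_of_hat_orbits:
  assumes datum: "weak_spherical_datum D \<Xi> \<Sigma> Sp"
    and s: "involution_on (hat_set D \<Sigma>) s" "involution_orbits (hat_set D \<Sigma>) s = hat D ` \<Sigma>"
  shows "is_folding (associated_datum D \<Sigma>) s"
proof -
  let ?E = "associated_datum D \<Sigma>"
  have orbit: "\<exists>\<sigma>\<in>\<Sigma>. {v, s v} = hat D \<sigma>" if "v \<in> hat_set D \<Sigma>" for v
  proof -
    have "{v, s v} \<in> involution_orbits (hat_set D \<Sigma>) s"
      using that by (simp add: involution_orbits_def)
    then show ?thesis using s(2) by auto
  qed
  have moved: "\<exists>\<gamma>1 \<gamma>2. v = coroot D \<gamma>1 \<and> s v = coroot D \<gamma>2 \<and> \<gamma>1 \<in> roots D \<and> \<gamma>2 \<in> roots D \<and>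
      form \<gamma>1 \<gamma>2 = 0 \<and> \<gamma>1 + \<gamma>2 \<in> \<Sigma> \<and> (\<forall>\<tau>\<in>\<Sigma>. \<langle>\<tau> | \<gamma>1\<rangle> = \<langle>\<tau> | \<gamma>2\<rangle>)"
    if v: "v \<in> hat_set D \<Sigma>" "v \<noteq> s v" for v
  proof -
    obtain \<sigma> where \<sigma>: "\<sigma> \<in> \<Sigma>" "{v, s v} = hat D \<sigma>" using orbit v(1) by blast
    have nonroot: "\<sigma> \<notin> roots D" using \<sigma>(2) v(2) by (auto simp: hat_root)
    have "v \<in> hat D \<sigma>" using \<sigma>(2) by blast
    then obtain \<gamma>1 \<gamma>2 where *: "v = coroot D \<gamma>1" "hat D \<sigma> = {coroot D \<gamma>1, coroot D \<gamma>2}"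
      "\<gamma>1 \<in> roots D" "\<gamma>2 \<in> roots D" "\<sigma> = \<gamma>1 + \<gamma>2" "form \<gamma>1 \<gamma>2 = 0"
      "\<And>\<tau>. \<tau> \<in> \<Sigma> \<Longrightarrow> \<langle>\<tau> | \<gamma>1\<rangle> = \<langle>\<tau> | \<gamma>2\<rangle>"
      using nonroot_hatE [OF datum \<sigma>(1) nonroot] by metis
    then have "s v = coroot D \<gamma>2" using \<sigma>(2) v(2) by (auto simp: doubleton_eq_iff)
    then show ?thesis using * \<sigma>(1) by blast
  qed
  have sum: "\<exists>\<tau>\<in>\<Sigma>. coroot ?E w + coroot ?E (s w) = \<tau> \<or> coroot ?E w + coroot ?E (s w) = \<tau> + \<tau>"
    if w: "w \<in> hat_set D \<Sigma>" for w
  proof (cases "w = s w")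
    case False
    then show ?thesis using moved [OF w] coroot_associated_datum by metis
  next
    case True
    obtain \<tau> where \<tau>: "\<tau> \<in> \<Sigma>" "{w, s w} = hat D \<tau>" using orbit w by blast
    show ?thesis
    proof (cases "\<tau> \<in> roots D")
      case root: True
      then have "w = coroot D \<tau>" using \<tau>(2) by (auto simp: hat_root doubleton_eq_iff)
      then show ?thesis using \<tau>(1) True coroot_associated_datum [OF root] by auto
    next
      case False
      have "w \<in> hat D \<tau>" using \<tau>(2) by blast
      then obtain \<gamma>1 \<gamma>2 where *: "w = coroot D \<gamma>1" "hat D \<tau> = {coroot D \<gamma>1, coroot D \<gamma>2}"
        "\<gamma>1 \<in> roots D" "\<gamma>2 \<in> roots D" "\<tau> = \<gamma>1 + \<gamma>2"
        using nonroot_hatE [OF datum \<tau>(1) False] by metis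
      have "s w = coroot D \<gamma>2" using \<tau>(2) True * by (auto simp: doubleton_eq_iff)
      then show ?thesis using * \<tau>(1) coroot_associated_datum by auto
    qed
  qed
  show ?thesis
    unfolding is_folding_def associated_datum_simps
  proof (intro conjI ballI impI)
    show "involution_on (hat_set D \<Sigma>) s" by (rule s)
  next
    fix v assume "v \<in> hat_set D \<Sigma>" "v \<noteq> s v"
    then obtain \<gamma>1 \<gamma>2 where \<gamma>: "v = coroot D \<gamma>1" "s v = coroot D \<gamma>2" "\<gamma>1 \<in> roots D" "\<gamma>2 \<in> roots D"
      "form \<gamma>1 \<gamma>2 = 0" using moved by blast
    then show "pairing D (coroot ?E (s v)) v = 0"
      using form_0_imp_pairing_0 [OF \<gamma>(3), of \<gamma>2] by (simp add: coroot_associated_datum form_commute)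
  next
    fix v w assume v: "v \<in> hat_set D \<Sigma>" and w: "w \<in> hat_set D \<Sigma>"
    have "pairing D x (v - s v) = 0" if "\<tau> \<in> \<Sigma>" "x = \<tau> \<or> x = \<tau> + \<tau>" for x \<tau>
      using moved [OF v] that by (cases "v = s v") (auto simp: pairing_linear)
    then show "pairing D (coroot ?E w + coroot ?E (s w)) (v - s v) = 0"
      using sum [OF w] by blast
  qed
qed

end

theorem lemma7p6:
  fixes D :: "('l::ab_group_add, 'm::ab_group_add) root_datum"
    and \<Xi> \<Sigma> Sp :: "'l set"
  assumes "based_root_datum D"
    and "weak_spherical_datum D \<Xi> \<Sigma> Sp"
  shows "(\<exists>!s. involution_on (hat_set D \<Sigma>) s \<and> involution_orbits (hat_set D \<Sigma>) s = hat D ` \<Sigma>) \<and>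
    (\<forall>s. involution_on (hat_set D \<Sigma>) s \<and> involution_orbits (hat_set D \<Sigma>) s = hat D ` \<Sigma> \<longrightarrow>
      is_folding (associated_datum D \<Sigma>) s)"
proof -
  interpret based_root_datum D by (rule assms(1))
  have "\<exists>!s. involution_on (\<Union>(hat D ` \<Sigma>)) s \<and> involution_orbits (\<Union>(hat D ` \<Sigma>)) s = hat D ` \<Sigma>"
  proof (rule ex1_involution_with_orbits)
    show "\<exists>v w. A = {v, w}" if "A \<in> hat D ` \<Sigma>" for A
      using that hat_eq_doubleton [OF assms(2)] by blast
    show "A = B" if "A \<in> hat D ` \<Sigma>" "B \<in> hat D ` \<Sigma>" "A \<inter> B \<noteq> {}" for A B
      using that hat_disjoint [OF assms(2)] by blast
  qed
  then show ?thesis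
    using folding_of_hat_orbits [OF assms(2)] by (simp add: hat_set_def)
qed

end
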